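(* Let $p\ge 2$. The Lie algebra $\mathfrak r_p=\{A\in gl(2p,\mathbb K):\ {}^tA\,\Theta_p+\Theta_pA=0\}$ admits the decomposition $$\mathfrak r_p=\mathfrak h_p\oplus\bigoplus_{\gamma\in\Gamma}\mathfrak m_{\gamma}$$ with (1) $\mathfrak h_p= sl(2)\times sl(2)\times\cdots\times sl(2)$ ($p$ times); (2) $[\mathfrak m_\gamma,\mathfrak m_\gamma]\subset\mathfrak h_p$ and $[\mathfrak m_\gamma,\mathfrak h_p]\subset\mathfrak m_\gamma$ for every $\gamma\in\Gamma$; (3) for distinct $\gamma,\gamma'\in\Gamma$, $[\mathfrak m_\gamma,\mathfrak m_{\gamma'}]\subset\mathfrak m_{\gamma+\gamma'}$ if $\gamma+\gamma'\in\Gamma$, and $[\mathfrak m_\gamma,\mathfrak m_{\gamma'}]=0$ otherwise. If $H_p$ is the semisimple Lie group $SL(2)^p$ (block-diagonal in $R_p$), then the homogeneous space $R_p/H_p$ is provided with a $\mathbb Z_2^{p-1}$-symmetric structure.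
   Context: $\mathbb K$ is an algebraically closed field of characteristic $0$; Lie-group notions are understood over $\mathbb K$ (complex Lie groups when $\mathbb K=\mathbb C$; linear algebraic groups for general $\mathbb K$). $\Theta_p$ is the $2p\times2p$ block-diagonal matrix with $p$ diagonal blocks equal to $\begin{pmatrix}0&1\\-1&0\end{pmatrix}$, and $R_p=\{A\in GL(2p,\mathbb K):{}^tA\Theta_pA=\Theta_p\}$, with Lie algebra $\mathfrak r_p$. Write $A\in\mathfrak r_p$ as a $p\times p$ array of $2\times 2$ blocks $A_{ij}$. $\mathfrak h_p$ is the subspace of block-diagonal elements of $\mathfrak r_p$. $\Gamma\subset\mathbb Z_2^{p-1}$ is the set of the $p(p-1)/2$ nonzero elements $(i_1,\dots,i_{p-1})$ such that if $i_k=1$ and $i_l=1$ with $l>k$ then $i_s=1$ for $s=k,k+1,\dots,l$ (the $1$'s form one block of consecutive positions). For $1\le i<j\le p$, let $\gamma_{ij}\in\Gamma$ be the element whose coordinates equal to $1$ are exactly those in positions $i,i+1,\dots,j-1$ counted from the right; $\mathfrak m_{\gamma_{ij}}$ is the subspace of elements of $\mathfrak r_p$ all of whose blocks vanish except possibly those in positions $(i,j)$ and $(j,i)$. For a finite abelian group $\Gamma'$, a Lie group $G$ and a closed subgroup $H$, a $\Gamma'$-symmetric structure on $G/H$ is an injective homomorphism $\Gamma'\to\mathrm{Aut}(G)$ such that $(G^{\Gamma'})_e\subset H\subset G^{\Gamma'}$, where $G^{\Gamma'}$ is the subgroup of elements fixed by all automorphisms in the image of $\Gamma'$ and $(G^{\Gamma'})_e$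 its identity component. *)

theory Defs
  imports
    "Jordan_Normal_Form.VS_Connect"
    "HOL-Algebra.Bij"
    "HOL-Algebra.Product_Groups"
    "HOL-Analysis.Function_Topology"
begin

section \<open>Matrix Lie algebras\<close>

abbreviation gl_space :: "'a::field itself \<Rightarrow> nat \<Rightarrow> ('a, 'a mat) module" where
  "gl_space ty n \<equiv> module_mat ty n n"

definition lie_bracket :: "'a::field mat \<Rightarrow> 'a mat \<Rightarrow> 'a mat" where
  "lie_bracket A B = A * B - B * A"

definition mat_subspace :: "nat \<Rightarrow> 'a::field mat set \<Rightarrow> bool" where
  "mat_subspace n V \<longleftrightarrow> VectorSpace.subspace class_ring V (gl_space TYPE('a) n)"

definition lie_subalgebra :: "nat \<Rightarrow> 'a::field mat set \<Rightarrow> bool" where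
  "lie_subalgebra n V \<longleftrightarrow> mat_subspace n V \<and> (\<forall>A\<in>V. \<forall>B\<in>V. lie_bracket A B \<in> V)"

definition bracket_space :: "nat \<Rightarrow> 'a::field mat set \<Rightarrow> 'a mat set \<Rightarrow> 'a mat set" where
  "bracket_space n V W =
     LinearCombinations.module.span class_ring (gl_space TYPE('a) n)
       {lie_bracket A B | A B. A \<in> V \<and> B \<in> W}"

text \<open>\<open>V\<close> is the internal direct sum of the subspace \<open>U\<close> and of the subspaces \<open>W i\<close>, \<open>i \<in> I\<close>.
  The uniqueness quantifier ranges over pairs consisting of a component in \<open>U\<close> and an
  extensional family of components in the \<open>W i\<close>.\<close>

definition is_direct_sum ::
    "nat \<Rightarrow> 'a::field mat set \<Rightarrow> 'a mat set \<Rightarrow> 'i set \<Rightarrow> ('i \<Rightarrow> 'a mat set) \<Rightarrow> bool" where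
  "is_direct_sum n V U I W \<longleftrightarrow>
     mat_subspace n V \<and>
     mat_subspace n U \<and> U \<subseteq> V \<and>
     finite I \<and> (\<forall>i\<in>I. mat_subspace n (W i) \<and> W i \<subseteq> V) \<and>
     (\<forall>A\<in>V. \<exists>!(X, Y). X \<in> U \<and> Y \<in> Pi\<^sub>E I W \<and>
        A = X + finsum (gl_space TYPE('a) n) Y I)"

text \<open>\<open>f\<close> is an isomorphism from the Lie algebra \<open>V\<close> onto the direct product of the Lie
  algebras \<open>W i\<close>, with componentwise operations.\<close>

definition lie_iso_product ::
    "('a::field mat \<Rightarrow> 'i \<Rightarrow> 'a mat) \<Rightarrow> 'a mat set \<Rightarrow> 'i set \<Rightarrow> ('i \<Rightarrow> 'a mat set) \<Rightarrow> bool" where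
  "lie_iso_product f V I W \<longleftrightarrow>
     bij_betw f V (Pi\<^sub>E I W) \<and>
     (\<forall>A\<in>V. \<forall>B\<in>V. f (A + B) = (\<lambda>i\<in>I. f A i + f B i)) \<and>
     (\<forall>c. \<forall>A\<in>V. f (c \<cdot>\<^sub>m A) = (\<lambda>i\<in>I. c \<cdot>\<^sub>m f A i)) \<and>
     (\<forall>A\<in>V. \<forall>B\<in>V. f (lie_bracket A B) = (\<lambda>i\<in>I. lie_bracket (f A i) (f B i)))"

definition sl_alg :: "nat \<Rightarrow> 'a::field mat set" where
  "sl_alg n = {A \<in> carrier_mat n n. (\<Sum>i<n. A $$ (i, i)) = 0}"

section \<open>Matrix groups\<close>

abbreviation GL :: "'a::field itself \<Rightarrow> nat \<Rightarrow> 'a mat monoid" where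
  "GL ty n \<equiv> units_of (ring_mat ty n ())"

definition SL_set :: "nat \<Rightarrow> 'a::field mat set" where
  "SL_set n = {A \<in> carrier_mat n n. det A = 1}"

subsection \<open>Linear algebraic groups\<close>

text \<open>The coordinate ring of \<open>GL(n)\<close>: polynomials in the matrix entries and the inverse of the
  determinant, viewed as functions (only their values on \<open>GL(n)\<close> matter).\<close>

inductive_set regular_functions :: "nat \<Rightarrow> ('a::field mat \<Rightarrow> 'a) set" for n where
  const: "(\<lambda>_. c) \<in> regular_functions n"
| entry: "i < n \<Longrightarrow> j < n \<Longrightarrow> (\<lambda>A. A $$ (i, j)) \<in> regular_functions n"
| inv_det: "(\<lambda>A. inverse (det A)) \<in> regular_functions n"
| add: "f \<in> regular_functions n \<Longrightarrow> g \<in> regular_functions n \<Longrightarrow>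
    (\<lambda>A. f A + g A) \<in> regular_functions n"
| mult: "f \<in> regular_functions n \<Longrightarrow> g \<in> regular_functions n \<Longrightarrow>
    (\<lambda>A. f A * g A) \<in> regular_functions n"

text \<open>The Zariski topology on \<open>GL(n)\<close>, generated by the principal open sets; its closed sets are
  the common zero sets in \<open>GL(n)\<close> of families of regular functions.\<close>

definition zariski_GL :: "'a::field itself \<Rightarrow> nat \<Rightarrow> 'a mat topology" where
  "zariski_GL ty n = topology_generated_by
     {{A \<in> carrier (GL TYPE('a) n). f A \<noteq> 0} | f. f \<in> regular_functions n}"

definition regular_map :: "nat \<Rightarrow> 'a::field mat set \<Rightarrow> ('a mat \<Rightarrow> 'a mat) \<Rightarrow> bool" where
  "regular_map n X f \<longleftrightarrow>
     (\<forall>i<n. \<forall>j<n. \<exists>g \<in> regular_functions n. \<forall>A\<in>X. f A $$ (i, j) = g A)"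

subsection \<open>Complex Lie groups\<close>

definition classical_mat :: "nat \<Rightarrow> complex mat topology" where
  "classical_mat n = pullback_topology (carrier_mat n n)
     (\<lambda>A. \<lambda>ij \<in> {..<n} \<times> {..<n}. A $$ ij)
     (product_topology (\<lambda>_. euclidean) ({..<n} \<times> {..<n}))"

definition classical_GL :: "nat \<Rightarrow> complex mat topology" where
  "classical_GL n = subtopology (classical_mat n) (carrier (GL TYPE(complex) n))"

text \<open>Complex (Frechet) differentiability of a function of the \<open>n * n\<close> matrix entries;
  \<open>L\<close> is the matrix of partial derivatives.\<close>

definition complex_differentiable_mat :: "nat \<Rightarrow> (complex mat \<Rightarrow> complex) \<Rightarrow> complex mat \<Rightarrow> bool" where
  "complex_differentiable_mat n g A \<longleftrightarrow>
     (\<exists>L :: nat \<Rightarrow> nat \<Rightarrow> complex. \<forall>\<epsilon>>0. \<exists>\<delta>>0. \<forall>B \<in> carrier_mat n n.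
        (\<forall>i<n. \<forall>j<n. cmod (B $$ (i, j) - A $$ (i, j)) < \<delta>) \<longrightarrow>
        cmod (g B - g A - (\<Sum>i<n. \<Sum>j<n. L i j * (B $$ (i, j) - A $$ (i, j))))
          \<le> \<epsilon> * (\<Sum>i<n. \<Sum>j<n. cmod (B $$ (i, j) - A $$ (i, j))))"

text \<open>Holomorphy of a matrix-valued map on a complex submanifold \<open>X\<close> of the \<open>n \<times> n\<close> matrices,
  expressed by local holomorphic extensions to the ambient space.\<close>

definition holomorphic_map :: "nat \<Rightarrow> complex mat set \<Rightarrow> (complex mat \<Rightarrow> complex mat) \<Rightarrow> bool" where
  "holomorphic_map n X f \<longleftrightarrow>
     (\<forall>A\<in>X. \<exists>U F. openin (classical_mat n) U \<and> A \<in> U \<and>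
        (\<forall>B \<in> U \<inter> X. F B = f B) \<and>
        (\<forall>B\<in>U. \<forall>i<n. \<forall>j<n. complex_differentiable_mat n (\<lambda>C. F C $$ (i, j)) B))"

subsection \<open>Symmetric structures\<close>

text \<open>The group \<open>Aut(G)\<close>, for the notion of morphism given by \<open>mor X f\<close> (\<open>f\<close> is regular, respectively
  holomorphic, on \<open>X\<close>).\<close>

definition Aut_group ::
    "('a mat set \<Rightarrow> ('a mat \<Rightarrow> 'a mat) \<Rightarrow> bool) \<Rightarrow> 'a mat monoid \<Rightarrow> ('a mat \<Rightarrow> 'a mat) monoid" where
  "Aut_group mor G = (AutoGroup G)\<lparr>carrier :=
     {f \<in> auto G. mor (carrier G) f \<and> mor (carrier G) (inv_into (carrier G) f)}\<rparr>"

definition fixed_subgroup ::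
    "'s monoid \<Rightarrow> 'a mat monoid \<Rightarrow> ('s \<Rightarrow> 'a mat \<Rightarrow> 'a mat) \<Rightarrow> 'a mat set" where
  "fixed_subgroup S G \<phi> = {A \<in> carrier G. \<forall>s \<in> carrier S. \<phi> s A = A}"

text \<open>\<open>\<phi>\<close> is an \<open>S\<close>-symmetric structure on \<open>G/H\<close>, where \<open>G\<close> is a closed subgroup of \<open>GL(n)\<close>, the
  latter carrying the topology \<open>T\<close>.\<close>

definition symmetric_structure ::
    "nat \<Rightarrow> 'a::field mat topology \<Rightarrow> ('a mat set \<Rightarrow> ('a mat \<Rightarrow> 'a mat) \<Rightarrow> bool) \<Rightarrow>
     's monoid \<Rightarrow> 'a mat monoid \<Rightarrow> 'a mat set \<Rightarrow> ('s \<Rightarrow> 'a mat \<Rightarrow> 'a mat) \<Rightarrow> bool" where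
  "symmetric_structure n T mor S G H \<phi> \<longleftrightarrow>
     comm_group S \<and> finite (carrier S) \<and>
     subgroup (carrier G) (GL TYPE('a) n) \<and> G = (GL TYPE('a) n)\<lparr>carrier := carrier G\<rparr> \<and>
     closedin T (carrier G) \<and>
     subgroup H G \<and> closedin (subtopology T (carrier G)) H \<and>
     \<phi> \<in> hom S (Aut_group mor G) \<and> inj_on \<phi> (carrier S) \<and>
     connected_component_of_set (subtopology T (fixed_subgroup S G \<phi>)) \<one>\<^bsub>G\<^esub> \<subseteq> H \<and>
     H \<subseteq> fixed_subgroup S G \<phi>"

definition algebraic_symmetric_structure ::
    "nat \<Rightarrow> 's monoid \<Rightarrow> 'a::field mat monoid \<Rightarrow> 'a mat set \<Rightarrow> ('s \<Rightarrow> 'a mat \<Rightarrow> 'a mat) \<Rightarrow> bool" where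
  "algebraic_symmetric_structure n = symmetric_structure n (zariski_GL TYPE('a) n) (regular_map n)"

definition complex_symmetric_structure ::
    "nat \<Rightarrow> 's monoid \<Rightarrow> complex mat monoid \<Rightarrow> complex mat set \<Rightarrow>
     ('s \<Rightarrow> complex mat \<Rightarrow> complex mat) \<Rightarrow> bool" where
  "complex_symmetric_structure n = symmetric_structure n (classical_GL n) (holomorphic_map n)"

section \<open>The symplectic groups and their grading\<close>

definition Theta :: "nat \<Rightarrow> 'a::field mat" where
  "Theta p = diag_block_mat (replicate p (mat_of_rows_list 2 [[0, 1], [- 1, 0]]))"

definition R_group :: "nat \<Rightarrow> 'a::field mat monoid" where
  "R_group p = (GL TYPE('a) (2 * p))\<lparr>carrier :=
     {A \<in> carrier (GL TYPE('a) (2 * p)). transpose_mat A * Theta p * A = Theta p}\<rparr>"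

definition r_alg :: "nat \<Rightarrow> 'a::field mat set" where
  "r_alg p = {A \<in> carrier_mat (2 * p) (2 * p).
     transpose_mat A * Theta p + Theta p * A = 0\<^sub>m (2 * p) (2 * p)}"

text \<open>The \<open>2 \<times> 2\<close> block in position \<open>(i, j)\<close>, with blocks numbered from 1 (matrix entries are
  numbered from 0).\<close>

definition block :: "'a mat \<Rightarrow> nat \<Rightarrow> nat \<Rightarrow> 'a mat" where
  "block A i j = mat 2 2 (\<lambda>(a, b). A $$ (2 * (i - 1) + a, 2 * (j - 1) + b))"

definition blocks_vanish_outside :: "nat \<Rightarrow> (nat \<times> nat) set \<Rightarrow> 'a::zero mat \<Rightarrow> bool" where
  "blocks_vanish_outside p S A \<longleftrightarrow>
     (\<forall>i\<in>{1..p}. \<forall>j\<in>{1..p}. (i, j) \<notin> S \<longrightarrow> block A i j = 0\<^sub>m 2 2)"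

definition h_alg :: "nat \<Rightarrow> 'a::field mat set" where
  "h_alg p = {A \<in> r_alg p. blocks_vanish_outside p {(i, i) | i. True} A}"

definition diagonal_blocks :: "nat \<Rightarrow> 'a mat \<Rightarrow> nat \<Rightarrow> 'a mat" where
  "diagonal_blocks p A = (\<lambda>i\<in>{1..p}. block A i i)"

definition H_group :: "nat \<Rightarrow> 'a::field mat set" where
  "H_group p = {A \<in> carrier_mat (2 * p) (2 * p).
     blocks_vanish_outside p {(i, i) | i. True} A \<and> (\<forall>i\<in>{1..p}. block A i i \<in> SL_set 2)}"

text \<open>\<open>\<int>\<^sub>2\<^bsup>n\<^esup>\<close>, with coordinates numbered \<open>1, \<dots>, n\<close> from the left.\<close>

definition Z2_power :: "nat \<Rightarrow> (nat \<Rightarrow> int) monoid" where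
  "Z2_power n = product_group {1..n} (\<lambda>_. integer_mod_group 2)"

definition Gamma_set :: "nat \<Rightarrow> (nat \<Rightarrow> int) set" where
  "Gamma_set p = {g \<in> carrier (Z2_power (p - 1)). g \<noteq> \<one>\<^bsub>Z2_power (p - 1)\<^esub> \<and>
     (\<forall>k\<in>{1..p - 1}. \<forall>l\<in>{1..p - 1}. k < l \<and> g k = 1 \<and> g l = 1 \<longrightarrow> (\<forall>s\<in>{k..l}. g s = 1))}"

text \<open>The coordinate numbered \<open>k\<close> from the left is in position \<open>p - k\<close> counted from the right.\<close>

definition gamma_elt :: "nat \<Rightarrow> nat \<Rightarrow> nat \<Rightarrow> nat \<Rightarrow> int" where
  "gamma_elt p i j = (\<lambda>k\<in>{1..p - 1}. if p - k \<in> {i..j - 1} then 1 else 0)"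

definition index_pairs :: "nat \<Rightarrow> (nat \<times> nat) set" where
  "index_pairs p = {(i, j). 1 \<le> i \<and> i < j \<and> j \<le> p}"

definition m_alg :: "nat \<Rightarrow> (nat \<Rightarrow> int) \<Rightarrow> 'a::field mat set" where
  "m_alg p g = (case the_inv_into (index_pairs p) (\<lambda>(i, j). gamma_elt p i j) g of
     (i, j) \<Rightarrow> {A \<in> r_alg p. blocks_vanish_outside p {(i, j), (j, i)} A})"

text \<open>The inverse used in \<open>m_alg\<close> is meaningful: the elements of \<open>Gamma_set p\<close> correspond
  bijectively to the pairs \<open>i < j\<close>.\<close>

lemma inj_on_gamma_elt: "inj_on (\<lambda>(i, j). gamma_elt p i j) (index_pairs p)"
proof (rule inj_onI, clarsimp simp: index_pairs_def)
  fix i j i' j' assume *: "Suc 0 \<le> i" "i < j" "j \<le> p" "Suc 0 \<le> i'" "i' < j'" "j' \<le> p"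
    and eq: "gamma_elt p i j = gamma_elt p i' j'"
  have iff: "i \<le> k \<and> k < j \<longleftrightarrow> i' \<le> k \<and> k < j'" if "1 \<le> k" "k < p" for k
  proof -
    have "p - k \<in> {1..p - 1}" "p - (p - k) = k" using that by auto
    then have val: "gamma_elt p a b (p - k) = (if k \<in> {a..b - 1} then 1 else 0)" for a b
      by (simp add: gamma_elt_def)
    have "k \<in> {i..j - 1} \<longleftrightarrow> k \<in> {i'..j' - 1}"
      using val[of i j] val[of i' j'] eq by (metis zero_neq_one)
    moreover have "k \<in> {a..b - 1} \<longleftrightarrow> a \<le> k \<and> k < b" if "a < b" for a b
      using that by auto
    ultimately show ?thesis using * by simp
  qed
  have "{i..<j} = {i'..<j'}"
  proof (rule Set.set_eqI)
    fix k show "k \<in> {i..<j} \<longleftrightarrow> k \<in> {i'..<j'}"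
      using iff[of k] * by (cases "1 \<le> k \<and> k < p") auto
  qed
  then show "i = i' \<and> j = j'" by (simp add: Set_Interval.atLeastLessThan_eq_iff[OF *(2,5)])
qed

lemma bij_betw_gamma_elt:
  "bij_betw (\<lambda>(i, j). gamma_elt p i j) (index_pairs p) (Gamma_set p)"
proof -
  have sub: "gamma_elt p i j \<in> Gamma_set p" if "(i, j) \<in> index_pairs p" for i j
  proof -
    have *: "1 \<le> i" "i < j" "j \<le> p" using that by (auto simp: index_pairs_def)
    have "gamma_elt p i j (p - i) = 1" using * by (auto simp: gamma_elt_def)
    moreover have "p - i \<in> {1..p - 1}" using * by auto
    moreover have "\<one>\<^bsub>Z2_power (p - 1)\<^esub> (p - i) = 0" if "p - i \<in> {1..p - 1}"
      using that by (simp add: Z2_power_def)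
    ultimately have "gamma_elt p i j \<noteq> \<one>\<^bsub>Z2_power (p - 1)\<^esub>" by fastforce
    moreover have "gamma_elt p i j \<in> carrier (Z2_power (p - 1))"
      by (auto simp: Z2_power_def carrier_integer_mod_group gamma_elt_def)
    moreover have "gamma_elt p i j s = 1"
      if "k \<in> {1..p - 1}" "l \<in> {1..p - 1}" "gamma_elt p i j k = 1" "gamma_elt p i j l = 1"
        "s \<in> {k..l}" for k l s
    proof -
      have "p - k \<in> {i..j - 1}" "p - l \<in> {i..j - 1}"
        using that(1-4) by (simp_all add: gamma_elt_def split: if_splits)
      then have "p - s \<in> {i..j - 1}" using that(5) by auto
      moreover have "s \<in> {1..p - 1}" using that(1,2,5) by auto
      ultimately show ?thesis by (simp add: gamma_elt_def)
    qed
    ultimately show ?thesis unfolding Gamma_set_def by blast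
  qed
  have sup: "\<exists>i j. (i, j) \<in> index_pairs p \<and> g = gamma_elt p i j" if g: "g \<in> Gamma_set p" for g
  proof -
    define S where "S = {k \<in> {1..p - 1}. g k = 1}"
    have E: "g \<in> extensional {1..p - 1}" and V: "\<And>k. k \<in> {1..p - 1} \<Longrightarrow> g k = 0 \<or> g k = 1"
    proof -
      have gP: "g \<in> (\<Pi>\<^sub>E k\<in>{1..p - 1}. {0..<2})"
        using g by (simp add: Gamma_set_def Z2_power_def carrier_integer_mod_group)
      then show "g \<in> extensional {1..p - 1}" by (simp add: PiE_def)
      show "g k = 0 \<or> g k = 1" if "k \<in> {1..p - 1}" for k
        using PiE_mem[OF gP that] by auto
    qed
    have conv: "g s = 1" if "k \<in> S" "l \<in> S" "k \<le> s" "s \<le> l" for k l s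
    proof (cases "k = l")
      case True then show ?thesis using that by (auto simp: S_def)
    next
      case False
      then have "k < l" "s \<in> {k..l}" using that by auto
      then show ?thesis using g that unfolding Gamma_set_def S_def by blast
    qed
    have "S \<noteq> {}"
    proof
      assume "S = {}"
      then have "g k = 0" if "k \<in> {1..p - 1}" for k using V[OF that] that by (auto simp: S_def)
      then have "g = (\<lambda>k\<in>{1..p - 1}. 0)" using E by (auto simp: extensional_def restrict_def)
      then show False using g by (simp add: Gamma_set_def Z2_power_def)
    qed
    moreover have "finite S" by (simp add: S_def)
    ultimately have mm: "Min S \<in> S" "Max S \<in> S" "\<And>k. k \<in> S \<Longrightarrow> Min S \<le> k \<and> k \<le> Max S" by auto
    have rng: "1 \<le> Min S" "Min S \<le> Max S" "Max S \<le> p - 1" using mm by (auto simp: S_def)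
    have "g = gamma_elt p (p - Max S) (p - Min S + 1)"
    proof
      fix k
      show "g k = gamma_elt p (p - Max S) (p - Min S + 1) k"
      proof (cases "k \<in> {1..p - 1}")
        case False then show ?thesis using E by (auto simp: extensional_def gamma_elt_def)
      next
        case True
        have "g k = 1 \<longleftrightarrow> Min S \<le> k \<and> k \<le> Max S"
        proof
          assume "g k = 1"
          then have "k \<in> S" using True by (simp add: S_def)
          then show "Min S \<le> k \<and> k \<le> Max S" by (rule mm(3))
        next
          assume "Min S \<le> k \<and> k \<le> Max S"
          then show "g k = 1" using conv[OF mm(1,2)] by blast
        qed
        moreover have "p - k \<in> {p - Max S..p - Min S + 1 - 1} \<longleftrightarrow> Min S \<le> k \<and> k \<le> Max S"
        proof -
          have "1 \<le> k" "k \<le> p - 1" using True by auto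
          then show ?thesis using rng unfolding atLeastAtMost_iff by arith
        qed
        moreover have "gamma_elt p (p - Max S) (p - Min S + 1) k =
            (if p - k \<in> {p - Max S..p - Min S + 1 - 1} then 1 else 0)"
          using True by (simp add: gamma_elt_def del: atLeastAtMost_iff)
        ultimately show ?thesis using V[OF True] by presburger
      qed
    qed
    moreover have "(p - Max S, p - Min S + 1) \<in> index_pairs p"
    proof -
      have "1 \<le> p - Max S" "p - Max S < p - Min S + 1" "p - Min S + 1 \<le> p"
        using rng by arith+
      then show ?thesis by (simp add: index_pairs_def)
    qed
    ultimately show ?thesis by blast
  qed
  show ?thesis
    unfolding bij_betw_def
  proof (intro conjI inj_on_gamma_elt subset_antisym subsetI)
    fix g assume "g \<in> (\<lambda>(i, j). gamma_elt p i j) ` index_pairs p"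
    then show "g \<in> Gamma_set p" using sub by auto
  next
    fix g assume "g \<in> Gamma_set p"
    then obtain i j where "(i, j) \<in> index_pairs p" "g = gamma_elt p i j" using sup by blast
    then show "g \<in> (\<lambda>(i, j). gamma_elt p i j) ` index_pairs p"
      by (intro image_eqI[of _ _ "(i, j)"]) simp_all
  qed
qed

lemma m_alg_gamma_elt:
  assumes "(i, j) \<in> index_pairs p"
  shows "m_alg p (gamma_elt p i j) = {A \<in> r_alg p. blocks_vanish_outside p {(i, j), (j, i)} A}"
  using the_inv_into_f_f[OF inj_on_gamma_elt assms] by (simp add: m_alg_def)

end

theory Submission
  imports Defs "HOL-Analysis.Abstract_Limits"
begin

text \<open>
  Everything rests on one assignment of degrees. Let \<open>\<epsilon>\<^sub>i\<close> be the element of \<open>\<int>\<^sub>2\<^bsup>p-1\<^esup>\<close> whose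
  coordinates equal to 1 are those in positions \<open>i, i + 1, \<dots>\<close> from the right, and give the
  matrix entries in block \<open>(i, j)\<close> the degree \<open>\<epsilon>\<^sub>i + \<epsilon>\<^sub>j\<close>. For \<open>i < j\<close> the coordinates in positions
  \<open>j, j + 1, \<dots>\<close> cancel, so this degree is \<open>\<gamma>\<^sub>i\<^sub>j\<close>; for \<open>i = j\<close> it is 0. The elements of \<open>r_alg p\<close>
  concentrated in degree \<open>g\<close> (\<open>graded_part\<close>) therefore form \<open>\<hh>\<^sub>p\<close> when \<open>g = 0\<close>, \<open>\<mm>\<^sub>g\<close> when
  \<open>g \<in> \<Gamma>\<close>, and the zero space for every other \<open>g\<close>. Since \<open>(\<epsilon>\<^sub>i + \<epsilon>\<^sub>k) + (\<epsilon>\<^sub>k + \<epsilon>\<^sub>j) = \<epsilon>\<^sub>i + \<epsilon>\<^sub>j\<close>,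
  the degree is additive under matrix multiplication, hence under the bracket. This gives all
  bracket relations at once (\<open>bracket_space_graded\<close>), with no case distinction on how two pairs of
  indices overlap: two equal degrees add up to 0, and the sum of two different ones is either in
  \<open>\<Gamma>\<close> or the degree of the zero space. The direct sum decomposition is the sorting of the
  entries by degree. It stays inside \<open>r_alg p\<close> because the condition defining this Lie algebra only
  relates entries in block \<open>(i, j)\<close> to entries in block \<open>(j, i)\<close>, which has the same degree. On a
  diagonal block the condition says that the trace vanishes, whence the copies of \<open>sl(2)\<close>.

  For the group, \<open>\<int>\<^sub>2\<^bsup>p-1\<^esup>\<close> acts on \<open>R_group p\<close> by conjugation with block-diagonal matrices whose
  blocks are \<open>\<plusminus>1\<close>, the first one being \<open>+1\<close>; the other signs are read off from the coordinates.
  Such a conjugation multiplies the entries in block \<open>(i, j)\<close> by the product of the signs of \<open>i\<close> and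
  \<open>j\<close>, so a matrix is fixed by the whole group exactly if it is block-diagonal. A block-diagonal
  matrix is symplectic if and only if its blocks have determinant 1, so the fixed subgroup is
  \<open>H_group p\<close> itself (\<open>fixed_subgroup_sign_action\<close>) and both inclusions in the definition of a
  symmetric structure are immediate. Injectivity of the action is tested on a unipotent symplectic
  matrix with a nonzero entry in block \<open>(1, k + 1)\<close>. All subsets involved are zero sets of
  polynomials; regular functions are continuous for the classical topology, so one argument about
  Zariski-closed sets serves both for algebraic groups and for complex Lie groups.
\<close>

section \<open>Spaces of matrices\<close>

lemma mat_subspaceI:
  assumes "V \<subseteq> carrier_mat n n" "0\<^sub>m n n \<in> V"
    and "\<And>A B. A \<in> V \<Longrightarrow> B \<in> V \<Longrightarrow> A + B \<in> V"
    and "\<And>c A. A \<in> V \<Longrightarrow> c \<cdot>\<^sub>m A \<in> V"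
  shows "mat_subspace n (V :: 'a::field mat set)"
proof -
  have vs: "vectorspace class_ring (gl_space TYPE('a) n)" by (rule matrix_vs)
  then have "Module.module class_ring (gl_space TYPE('a) n)" by (simp add: vectorspace_def)
  then have "LinearCombinations.submodule class_ring V (gl_space TYPE('a) n)"
    by (rule LinearCombinations.submodule.intro) (use assms in \<open>auto simp: module_mat_simps\<close>)
  with vs show ?thesis by (simp add: mat_subspace_def VectorSpace.subspace_def)
qed

lemma mat_subspaceD:
  assumes "mat_subspace n (V :: 'a::field mat set)"
  shows "LinearCombinations.submodule class_ring V (gl_space TYPE('a) n)"
  using assms by (simp add: mat_subspace_def VectorSpace.subspace_def)

lemma bracket_space_subset:
  assumes "mat_subspace n U" "\<And>A B. A \<in> V \<Longrightarrow> B \<in> W \<Longrightarrow> lie_bracket A B \<in> U"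
  shows "bracket_space n V W \<subseteq> (U :: 'a::field mat set)"
proof -
  interpret vectorspace class_ring "gl_space TYPE('a) n" by (rule matrix_vs)
  show ?thesis unfolding bracket_space_def
    by (rule span_is_subset[OF _ mat_subspaceD[OF assms(1)]]) (use assms(2) in auto)
qed

lemma zero_in_bracket_space: "0\<^sub>m n n \<in> bracket_space n V (W :: 'a::field mat set)"
proof -
  interpret vectorspace class_ring "gl_space TYPE('a) n" by (rule matrix_vs)
  have "\<zero>\<^bsub>gl_space TYPE('a) n\<^esub> = lincomb (\<lambda>_. \<zero>\<^bsub>class_ring\<^esub>) {}" by (simp add: lincomb_def)
  then show ?thesis unfolding bracket_space_def span_def
    by (auto simp: module_mat_simps intro!: exI[of _ "{}"])
qed

lemma index_finsum_mat:
  assumes "finite I" "Y \<in> I \<rightarrow> carrier_mat n n" "a < n" "b < n"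
  shows "finsum (gl_space TYPE('a::field) n) Y I \<in> carrier_mat n n"
    "finsum (gl_space TYPE('a) n) Y I $$ (a, b) = (\<Sum>i\<in>I. Y i $$ (a, b))"
proof -
  interpret vectorspace class_ring "gl_space TYPE('a) n" by (rule matrix_vs)
  have c: "finsum (gl_space TYPE('a) n) Y J \<in> carrier_mat n n" if "J \<subseteq> I" for J
    using finsum_closed[of Y J] that assms(2) by (auto simp: module_mat_simps Pi_def)
  show "finsum (gl_space TYPE('a) n) Y I \<in> carrier_mat n n" using c by blast
  have "finsum (gl_space TYPE('a) n) Y J $$ (a, b) = (\<Sum>i\<in>J. Y i $$ (a, b))" if "J \<subseteq> I" for J
    using finite_subset[OF that assms(1)] that
  proof (induction J rule: finite_induct)
    case empty
    then show ?case using assms by (simp add: module_mat_simps)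
  next
    case (insert x J)
    then have "Y \<in> J \<rightarrow> carrier (gl_space TYPE('a) n)" "Y x \<in> carrier (gl_space TYPE('a) n)"
      using assms(2) by (auto simp: module_mat_simps)
    then have "finsum (gl_space TYPE('a) n) Y (insert x J) = Y x + finsum (gl_space TYPE('a) n) Y J"
      using finsum_insert[of J x Y] insert by (simp add: module_mat_simps)
    then show ?case using insert c[of J] assms by auto
  qed
  then show "finsum (gl_space TYPE('a) n) Y I $$ (a, b) = (\<Sum>i\<in>I. Y i $$ (a, b))" by blast
qed

section \<open>The symplectic form in coordinates\<close>

text \<open>The coordinates come in hyperbolic pairs: \<open>\<Theta>\<close> maps the basis vector of index \<open>partner a\<close>
  to that of index \<open>a\<close>, up to the sign \<open>parity_sign a\<close>.\<close>

definition partner :: "nat \<Rightarrow> nat" where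
  "partner a = (if even a then a + 1 else a - 1)"

definition parity_sign :: "nat \<Rightarrow> 'a::ring_1" where
  "parity_sign a = (if even a then 1 else - 1)"

lemma partner_simps [simp]:
  "partner (partner a) = a" "partner a div 2 = a div 2"
  "parity_sign (partner a) = - parity_sign a"
  "parity_sign a * parity_sign a = 1" "parity_sign a * (parity_sign a * x) = x"
  by (auto simp: partner_def parity_sign_def elim!: oddE)

lemma partner_less [simp]: "partner a < 2 * p \<longleftrightarrow> a < 2 * p"
  by (auto simp: partner_def elim!: oddE evenE)

lemma eq_partner_iff: "a = partner b \<longleftrightarrow> b = partner a"
  by auto

lemma Theta_carrier [simp]: "Theta p \<in> carrier_mat (2 * p) (2 * p)"
  by (auto simp: Theta_def dim_diag_block_mat sum_list_replicate mat_of_rows_list_def)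

lemma Theta_dim [simp]: "dim_row (Theta p) = 2 * p" "dim_col (Theta p) = 2 * p"
  using Theta_carrier carrier_matD by blast+

lemma Theta_index:
  assumes "a < 2 * p" "b < 2 * p"
  shows "(Theta p :: 'a::field mat) $$ (a, b) = (if b = partner a then parity_sign a else 0)"
  using assms
proof (induction p arbitrary: a b)
  case 0
  then show ?case by simp
next
  case (Suc p)
  let ?J = "mat_of_rows_list 2 [[0, 1], [- 1, 0]] :: 'a mat"
  have d: "dim_row ?J = 2" "dim_col ?J = 2" by (simp_all add: mat_of_rows_list_def)
  have T: "Theta (Suc p) = four_block_mat ?J (0\<^sub>m 2 (2 * p)) (0\<^sub>m (2 * p) 2) (Theta p)"
    using d unfolding Theta_def by (simp add: Let_def Theta_dim[unfolded Theta_def])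
  consider "a < 2" "b < 2" | "a < 2" "b \<ge> 2" | "a \<ge> 2" "b < 2" | "a \<ge> 2" "b \<ge> 2" by linarith
  then show ?case
  proof cases
    case 1
    then have "a = 0 \<or> a = 1" "b = 0 \<or> b = 1" by auto
    then show ?thesis using 1 d
      by (auto simp: T partner_def parity_sign_def mat_of_rows_list_def)
  next
    case 2
    then have "b \<noteq> partner a" by (auto simp: partner_def)
    then show ?thesis using 2 d Suc.prems by (simp add: T)
  next
    case 3
    then have "b \<noteq> partner a" by (auto simp: partner_def elim!: oddE)
    then show ?thesis using 3 d Suc.prems by (simp add: T)
  next
    case 4
    then obtain a' b' where ab: "a = a' + 2" "b = b' + 2" by (metis le_add_diff_inverse2)
    then have "b = partner a \<longleftrightarrow> b' = partner a'"
      by (auto simp: partner_def elim!: oddE)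
    then show ?thesis using Suc.IH[of a' b'] Suc.prems 4 d
      by (simp add: T ab parity_sign_def)
  qed
qed

lemma Theta_mult_index:
  assumes "A \<in> carrier_mat (2 * p) (2 * p)" "a < 2 * p" "b < 2 * p"
  shows "(Theta p * A) $$ (a, b) = (parity_sign a * A $$ (partner a, b) :: 'a::field)"
proof -
  have "(Theta p * A) $$ (a, b) = (\<Sum>c<2 * p. Theta p $$ (a, c) * A $$ (c, b))"
    using assms by (auto simp: scalar_prod_def atLeast0LessThan intro!: sum.cong)
  also have "\<dots> = (\<Sum>c<2 * p. if c = partner a then parity_sign a * A $$ (partner a, b) else 0)"
    using assms by (intro sum.cong) (auto simp: Theta_index)
  finally show ?thesis using assms by simp
qed

lemma mult_Theta_index:
  assumes "A \<in> carrier_mat (2 * p) (2 * p)" "a < 2 * p" "b < 2 * p"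
  shows "(A * Theta p) $$ (a, b) = (- parity_sign b * A $$ (a, partner b) :: 'a::field)"
proof -
  have "(A * Theta p) $$ (a, b) = (\<Sum>c<2 * p. A $$ (a, c) * Theta p $$ (c, b))"
    using assms by (auto simp: scalar_prod_def atLeast0LessThan intro!: sum.cong)
  also have "\<dots> = (\<Sum>c<2 * p. if c = partner b then - parity_sign b * A $$ (a, partner b) else 0)"
    using assms by (intro sum.cong) (auto simp: Theta_index)
  finally show ?thesis using assms by simp
qed

lemma Theta_Theta: "Theta p * Theta p = - (1\<^sub>m (2 * p) :: 'a::field mat)"
  by (rule eq_matI) (auto simp: Theta_mult_index Theta_index eq_partner_iff simp del: index_mult_mat(1))

lemma r_alg_carrier: "A \<in> r_alg p \<Longrightarrow> A \<in> carrier_mat (2 * p) (2 * p)"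
  by (simp add: r_alg_def)

text \<open>The equation defining \<open>r_alg p\<close> relates the entry \<open>(partner a, b)\<close> to the entry
  \<open>(partner b, a)\<close> only. If the first lies in block \<open>(i, j)\<close>, the second lies in block \<open>(j, i)\<close>;
  this is why the decomposition by blocks is compatible with the equation.\<close>

lemma r_alg_iff:
  assumes "A \<in> carrier_mat (2 * p) (2 * p)"
  shows "(A :: 'a::field mat) \<in> r_alg p \<longleftrightarrow> (\<forall>a<2 * p. \<forall>b<2 * p.
    parity_sign a * A $$ (partner a, b) = parity_sign b * A $$ (partner b, a))"
proof -
  have "(transpose_mat A * Theta p + Theta p * A) $$ (a, b) =
      parity_sign a * A $$ (partner a, b) - parity_sign b * A $$ (partner b, a)"
    if "a < 2 * p" "b < 2 * p" for a b
    using assms that by (simp add: Theta_mult_index mult_Theta_index del: index_mult_mat(1))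
  moreover have "transpose_mat A * Theta p + Theta p * A = 0\<^sub>m (2 * p) (2 * p) \<longleftrightarrow>
      (\<forall>a<2 * p. \<forall>b<2 * p. (transpose_mat A * Theta p + Theta p * A) $$ (a, b) = 0)"
    using assms by (subst mat_eq_iff) auto
  ultimately show ?thesis using assms by (simp add: r_alg_def)
qed

lemma symplectic_form_index:
  assumes "A \<in> carrier_mat (2 * p) (2 * p)" "a < 2 * p" "b < 2 * p"
  shows "(transpose_mat A * Theta p * A) $$ (a, b) =
    (\<Sum>c<2 * p. parity_sign c * A $$ (c, a) * A $$ (partner c, b) :: 'a::field)"
proof -
  have "transpose_mat A * Theta p * A = transpose_mat A * (Theta p * A)"
    using assms by (intro assoc_mult_mat[of _ "2*p" "2*p" _ "2*p" _ "2*p"]) auto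
  then have "(transpose_mat A * Theta p * A) $$ (a, b) = (\<Sum>c<2 * p. A $$ (c, a) * (Theta p * A) $$ (c, b))"
    using assms by (auto simp: scalar_prod_def atLeast0LessThan simp del: index_mult_mat(1)
      simp add: index_mult_mat(1)[of _ "transpose_mat A"] intro!: sum.cong)
  then show ?thesis using assms
    by (auto simp: Theta_mult_index mult_ac simp del: index_mult_mat(1) intro!: sum.cong)
qed

lemma r_alg_transpose:
  assumes "X \<in> r_alg p"
  shows "transpose_mat X * Theta p = - (Theta p * (X :: 'a::field mat))"
proof -
  have X: "X \<in> carrier_mat (2 * p) (2 * p)"
    and z: "transpose_mat X * Theta p + Theta p * X = 0\<^sub>m (2 * p) (2 * p)"
    using assms by (auto simp: r_alg_def)
  show ?thesis
  proof (rule eq_matI)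
    fix a b assume "a < dim_row (- (Theta p * X))" "b < dim_col (- (Theta p * X))"
    then have ab: "a < 2 * p" "b < 2 * p" using X by auto
    have "(transpose_mat X * Theta p) $$ (a, b) + (Theta p * X) $$ (a, b) = 0"
      using arg_cong[OF z, of "\<lambda>M. M $$ (a, b)"] ab X by (simp del: index_mult_mat(1))
    then show "(transpose_mat X * Theta p) $$ (a, b) = (- (Theta p * X)) $$ (a, b)"
      using ab X by (simp add: eq_neg_iff_add_eq_0 del: index_mult_mat(1))
  qed (use X in auto)
qed

text \<open>Passing to the adjoint with respect to \<open>\<Theta>\<close> changes the sign of each factor and reverses
  their order, so it turns a commutator into its opposite.\<close>

lemma r_alg_mult:
  assumes A: "A \<in> r_alg p" and B: "(B :: 'a::field mat) \<in> r_alg p"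
  shows "transpose_mat (A * B) * Theta p = Theta p * (B * A)"
proof -
  note c = r_alg_carrier[OF A] r_alg_carrier[OF B]
  note neg = r_alg_transpose
  have "transpose_mat (A * B) * Theta p = transpose_mat B * (transpose_mat A * Theta p)"
    using c by (simp add: transpose_mult[OF c] assoc_mult_mat[of _ "2*p" "2*p" _ "2*p" _ "2*p"])
  also have "\<dots> = - (transpose_mat B * Theta p * A)"
    using c by (simp add: neg[OF A] assoc_mult_mat[of _ "2*p" "2*p" _ "2*p" _ "2*p"])
  also have "\<dots> = Theta p * (B * A)"
    using c by (simp add: neg[OF B] assoc_mult_mat[of _ "2*p" "2*p" _ "2*p" _ "2*p"])
  finally show ?thesis .
qed

lemma mat_subspace_r_alg: "mat_subspace (2 * p) (r_alg p :: 'a::field mat set)"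
proof (rule mat_subspaceI)
  show sub: "r_alg p \<subseteq> carrier_mat (2 * p) (2 * p)"
    by (auto dest: r_alg_carrier)
  show "0\<^sub>m (2 * p) (2 * p) \<in> r_alg p"
    by (simp add: r_alg_iff)
  fix A :: "'a mat" assume A: "A \<in> r_alg p"
  then have cA: "A \<in> carrier_mat (2 * p) (2 * p)" using sub by blast
  have rA: "parity_sign a * A $$ (partner a, b) = parity_sign b * A $$ (partner b, a)"
    if "a < 2 * p" "b < 2 * p" for a b using A that r_alg_iff[OF cA] by blast
  show "c \<cdot>\<^sub>m A \<in> r_alg p" for c
    using cA rA by (simp add: r_alg_iff mult.left_commute[of _ c])
  fix B :: "'a mat" assume B: "B \<in> r_alg p"
  then have cB: "B \<in> carrier_mat (2 * p) (2 * p)" using sub by blast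
  have rB: "parity_sign a * B $$ (partner a, b) = parity_sign b * B $$ (partner b, a)"
    if "a < 2 * p" "b < 2 * p" for a b using B that r_alg_iff[OF cB] by blast
  show "A + B \<in> r_alg p"
    using cA cB rA rB by (simp add: r_alg_iff distrib_left)
qed

lemma lie_bracket_in_r_alg:
  assumes A: "A \<in> r_alg p" and B: "(B :: 'a::field mat) \<in> r_alg p"
  shows "lie_bracket A B \<in> r_alg p"
proof -
  note c = r_alg_carrier[OF A] r_alg_carrier[OF B]
  have c': "A * B \<in> carrier_mat (2 * p) (2 * p)" "B * A \<in> carrier_mat (2 * p) (2 * p)"
    using c by auto
  have "transpose_mat (A * B - B * A) * Theta p = Theta p * (B * A) - Theta p * (A * B)"
    using c' by (simp add: transpose_minus minus_mult_distrib_mat[of _ "2*p" "2*p" _ _ "2*p"]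
        r_alg_mult[OF A B] r_alg_mult[OF B A])
  moreover have "Theta p * (A * B - B * A) = Theta p * (A * B) - Theta p * (B * A)"
    using c' by (simp add: mult_minus_distrib_mat[of _ "2*p" "2*p" _ "2*p"])
  ultimately show ?thesis using c c'
    by (auto simp: r_alg_def lie_bracket_def simp del: index_mult_mat(1))
qed

lemma blocks_vanish_outside_iff:
  "blocks_vanish_outside p S A \<longleftrightarrow> (\<forall>a<2 * p. \<forall>b<2 * p.
     (a div 2 + 1, b div 2 + 1) \<notin> S \<longrightarrow> A $$ (a, b) = (0 :: 'a::zero))"
proof (intro iffI allI impI)
  fix a b assume v: "blocks_vanish_outside p S A"
    and ab: "a < 2 * p" "b < 2 * p" "(a div 2 + 1, b div 2 + 1) \<notin> S"
  then have "block A (a div 2 + 1) (b div 2 + 1) = 0\<^sub>m 2 2"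
    by (auto simp: blocks_vanish_outside_def)
  then have "block A (a div 2 + 1) (b div 2 + 1) $$ (a mod 2, b mod 2) = 0" by simp
  then show "A $$ (a, b) = 0" by (simp add: block_def)
next
  assume v: "\<forall>a<2 * p. \<forall>b<2 * p. (a div 2 + 1, b div 2 + 1) \<notin> S \<longrightarrow> A $$ (a, b) = 0"
  show "blocks_vanish_outside p S A"
    unfolding blocks_vanish_outside_def
  proof (intro ballI impI)
    fix i j assume "i \<in> {1..p}" "j \<in> {1..p}" "(i, j) \<notin> S"
    then show "block A i j = 0\<^sub>m 2 2"
      using v by (auto simp: block_def mat_eq_iff)
  qed
qed

section \<open>The grading\<close>

lemma Z2_power_mult:
  "x \<otimes>\<^bsub>Z2_power n\<^esub> y = (\<lambda>k\<in>{1..n}. (x k + y k) mod 2)"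
  by (simp add: Z2_power_def)

lemma Z2_power_carrier: "carrier (Z2_power n) = (\<Pi>\<^sub>E k\<in>{1..n}. {0, 1})"
proof -
  have "{0..<2::int} = {0, 1}" by auto
  then show ?thesis by (simp add: Z2_power_def carrier_integer_mod_group)
qed

lemma comm_group_Z2_power: "comm_group (Z2_power n)"
proof (rule group.group_comm_groupI)
  show "group (Z2_power n)" by (simp add: Z2_power_def)
qed (simp add: Z2_power_mult add.commute)

lemma Z2_power_mult_self:
  assumes "x \<in> carrier (Z2_power n)"
  shows "x \<otimes>\<^bsub>Z2_power n\<^esub> x = \<one>\<^bsub>Z2_power n\<^esub>"
  using assms by (simp add: Z2_power_mult Z2_power_def mult_2[symmetric])

text \<open>This is \<open>\<epsilon>\<^sub>i + \<epsilon>\<^sub>j\<close>, where \<open>\<epsilon>\<^sub>i\<close> has its coordinates equal to 1 in the positions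
  \<open>i, i + 1, \<dots>\<close> counted from the right.\<close>

definition block_degree :: "nat \<Rightarrow> nat \<Rightarrow> nat \<Rightarrow> nat \<Rightarrow> int" where
  "block_degree p i j = (\<lambda>k\<in>{1..p - 1}. if (i \<le> p - k) = (j \<le> p - k) then 0 else 1)"

text \<open>The contribution of the middle index cancels; this makes the degree additive under matrix
  multiplication.\<close>

lemma block_degree_mult:
  "block_degree p i j \<otimes>\<^bsub>Z2_power (p - 1)\<^esub> block_degree p j k = block_degree p i k"
  by (auto simp: Z2_power_mult block_degree_def)

lemma block_degree_commute: "block_degree p i j = block_degree p j i"
  by (auto simp: block_degree_def)

lemma block_degree_self: "block_degree p i i = \<one>\<^bsub>Z2_power (p - 1)\<^esub>"
  by (simp add: block_degree_def Z2_power_def)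

lemma block_degree_eq_gamma_elt:
  assumes "(i, j) \<in> index_pairs p"
  shows "block_degree p i j = gamma_elt p i j"
  using assms by (auto simp: block_degree_def gamma_elt_def index_pairs_def fun_eq_iff restrict_def)

lemma gamma_elt_in_Gamma_set: "(i, j) \<in> index_pairs p \<Longrightarrow> gamma_elt p i j \<in> Gamma_set p"
  using bij_betwE[OF bij_betw_gamma_elt] by fastforce

lemma Gamma_set_cases:
  assumes "g \<in> Gamma_set p"
  obtains i j where "(i, j) \<in> index_pairs p" "g = gamma_elt p i j"
proof -
  have "g \<in> (\<lambda>(i, j). gamma_elt p i j) ` index_pairs p"
    using assms bij_betw_imp_surj_on[OF bij_betw_gamma_elt[of p]] by simp
  then show thesis using that by auto
qed

lemma finite_Gamma_set: "finite (Gamma_set p)"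
proof -
  have "finite (index_pairs p)"
    by (rule finite_subset[of _ "{..p} \<times> {..p}"]) (auto simp: index_pairs_def)
  then show ?thesis using bij_betw_finite[OF bij_betw_gamma_elt] by blast
qed

lemma one_notin_Gamma_set: "\<one>\<^bsub>Z2_power (p - 1)\<^esub> \<notin> Gamma_set p"
  by (simp add: Gamma_set_def)

lemma block_degree_cases:
  assumes "i \<in> {1..p}" "j \<in> {1..p}"
  shows "i = j \<and> block_degree p i j = \<one>\<^bsub>Z2_power (p - 1)\<^esub> \<or>
    (i, j) \<in> index_pairs p \<and> block_degree p i j = gamma_elt p i j \<or>
    (j, i) \<in> index_pairs p \<and> block_degree p i j = gamma_elt p j i"
proof -
  have "i = j \<or> (i, j) \<in> index_pairs p \<or> (j, i) \<in> index_pairs p"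
    using assms by (auto simp: index_pairs_def)
  then show ?thesis
    using block_degree_self block_degree_eq_gamma_elt block_degree_commute by metis
qed

lemma block_degree_eq_one_iff:
  assumes "i \<in> {1..p}" "j \<in> {1..p}"
  shows "block_degree p i j = \<one>\<^bsub>Z2_power (p - 1)\<^esub> \<longleftrightarrow> i = j"
  using block_degree_cases[OF assms] gamma_elt_in_Gamma_set one_notin_Gamma_set
  by (metis block_degree_self)

lemma block_degree_eq_gamma_elt_iff:
  assumes "i \<in> {1..p}" "j \<in> {1..p}" "(k, l) \<in> index_pairs p"
  shows "block_degree p i j = gamma_elt p k l \<longleftrightarrow> (i, j) = (k, l) \<or> (i, j) = (l, k)"
proof
  assume e: "block_degree p i j = gamma_elt p k l"
  then have "i \<noteq> j"
    using gamma_elt_in_Gamma_set[OF assms(3)] one_notin_Gamma_set by (metis block_degree_self)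
  have inj: "(a, b) = (k, l)"
    if "(a, b) \<in> index_pairs p" "gamma_elt p a b = gamma_elt p k l" for a b
    using inj_onD[OF inj_on_gamma_elt _ that(1) assms(3)] that(2) by simp
  show "(i, j) = (k, l) \<or> (i, j) = (l, k)"
    using block_degree_cases[OF assms(1,2)] \<open>i \<noteq> j\<close> inj e by auto
next
  assume "(i, j) = (k, l) \<or> (i, j) = (l, k)"
  then show "block_degree p i j = gamma_elt p k l"
    using block_degree_eq_gamma_elt[OF assms(3)] block_degree_commute by auto
qed

text \<open>Entries are numbered from 0 and blocks from 1.\<close>

abbreviation entry_degree :: "nat \<Rightarrow> nat \<Rightarrow> nat \<Rightarrow> nat \<Rightarrow> int" where
  "entry_degree p a b \<equiv> block_degree p (a div 2 + 1) (b div 2 + 1)"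

definition graded_part :: "nat \<Rightarrow> (nat \<Rightarrow> int) \<Rightarrow> 'a::field mat set" where
  "graded_part p g = {A \<in> r_alg p. \<forall>a<2 * p. \<forall>b<2 * p. entry_degree p a b \<noteq> g \<longrightarrow> A $$ (a, b) = 0}"

lemma block_number_in_range: "(a :: nat) < 2 * p \<Longrightarrow> a div 2 + 1 \<in> {1..p}"
  by auto

lemma graded_part_one: "graded_part p \<one>\<^bsub>Z2_power (p - 1)\<^esub> = (h_alg p :: 'a::field mat set)"
proof -
  have "entry_degree p a b \<noteq> \<one>\<^bsub>Z2_power (p - 1)\<^esub> \<longleftrightarrow>
      (a div 2 + 1, b div 2 + 1) \<notin> {(i, i) | i. True}" if "a < 2 * p" "b < 2 * p" for a b
    using that block_degree_eq_one_iff[OF block_number_in_range block_number_in_range] by auto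
  then show ?thesis
    unfolding graded_part_def h_alg_def blocks_vanish_outside_iff by blast
qed

lemma graded_part_Gamma:
  assumes "g \<in> Gamma_set p"
  shows "graded_part p g = (m_alg p g :: 'a::field mat set)"
proof -
  obtain i j where ij: "(i, j) \<in> index_pairs p" and g: "g = gamma_elt p i j"
    using Gamma_set_cases[OF assms] .
  have "entry_degree p a b \<noteq> g \<longleftrightarrow>
      (a div 2 + 1, b div 2 + 1) \<notin> {(i, j), (j, i)}" if "a < 2 * p" "b < 2 * p" for a b
    unfolding g block_degree_eq_gamma_elt_iff[OF block_number_in_range[OF that(1)] block_number_in_range[OF that(2)] ij]
    by simp
  then show ?thesis
    unfolding g m_alg_gamma_elt[OF ij] graded_part_def blocks_vanish_outside_iff
    unfolding g[symmetric] by blast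
qed

lemma entry_degree_cases:
  assumes "a < 2 * p" "b < 2 * p"
  shows "entry_degree p a b \<in> insert \<one>\<^bsub>Z2_power (p - 1)\<^esub> (Gamma_set p)"
  using block_degree_cases[OF assms[THEN block_number_in_range]] gamma_elt_in_Gamma_set by auto

lemma mat_subspace_graded_part: "mat_subspace (2 * p) (graded_part p g :: 'a::field mat set)"
proof (rule mat_subspaceI)
  interpret r_alg: submodule class_ring "r_alg p :: 'a mat set" "gl_space TYPE('a) (2 * p)"
    by (rule mat_subspaceD[OF mat_subspace_r_alg])
  show "graded_part p g \<subseteq> carrier_mat (2 * p) (2 * p)"
    by (auto simp: graded_part_def dest: r_alg_carrier)
  show "0\<^sub>m (2 * p) (2 * p) \<in> (graded_part p g :: 'a mat set)"
    using r_alg.zero_closed by (simp add: graded_part_def module_mat_simps)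
  show "c \<cdot>\<^sub>m A \<in> graded_part p g" if "A \<in> graded_part p g" for c and A :: "'a mat"
    using that r_alg.smult_closed[of c A] r_alg_carrier[of A p]
    by (auto simp: graded_part_def matrix_vs_simps)
  show "A + B \<in> graded_part p g"
    if "A \<in> graded_part p g" "B \<in> graded_part p g" for A B :: "'a mat"
    using that r_alg.m_closed[of A B] r_alg_carrier[of A p] r_alg_carrier[of B p]
    by (auto simp: graded_part_def matrix_vs_simps)
qed

lemma graded_mult_index:
  assumes "A \<in> graded_part p g" "B \<in> graded_part p g'" "a < 2 * p" "b < 2 * p"
    and "entry_degree p a b \<noteq> g \<otimes>\<^bsub>Z2_power (p - 1)\<^esub> g'"
  shows "(A * B) $$ (a, b) = (0 :: 'a::field)"
proof -
  have c: "A \<in> carrier_mat (2 * p) (2 * p)" "B \<in> carrier_mat (2 * p) (2 * p)"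
    using assms(1,2) by (auto simp: graded_part_def dest: r_alg_carrier)
  have "A $$ (a, c) * B $$ (c, b) = 0" if "c < 2 * p" for c
  proof (rule ccontr)
    assume "A $$ (a, c) * B $$ (c, b) \<noteq> 0"
    then have "entry_degree p a c = g" "entry_degree p c b = g'"
      using assms that by (auto simp: graded_part_def)
    then show False using assms(5) block_degree_mult by metis
  qed
  then show ?thesis using c assms by (auto simp: scalar_prod_def intro!: sum.neutral)
qed

lemma lie_bracket_graded:
  assumes A: "A \<in> graded_part p g" and B: "(B :: 'a::field mat) \<in> graded_part p g'"
  shows "lie_bracket A B \<in> graded_part p (g \<otimes>\<^bsub>Z2_power (p - 1)\<^esub> g')"
proof -
  have r: "A \<in> r_alg p" "B \<in> r_alg p" using A B by (auto simp: graded_part_def)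
  note c = r[THEN r_alg_carrier]
  have "lie_bracket A B $$ (a, b) = 0"
    if "a < 2 * p" "b < 2 * p" "entry_degree p a b \<noteq> g \<otimes>\<^bsub>Z2_power (p - 1)\<^esub> g'" for a b
  proof -
    have "g \<otimes>\<^bsub>Z2_power (p - 1)\<^esub> g' = g' \<otimes>\<^bsub>Z2_power (p - 1)\<^esub> g"
      by (simp add: Z2_power_mult add.commute)
    then show ?thesis
      using graded_mult_index[OF A B that] graded_mult_index[OF B A that(1,2)] that c
      by (simp add: lie_bracket_def del: index_mult_mat(1))
  qed
  then show ?thesis using lie_bracket_in_r_alg[OF r] by (simp add: graded_part_def)
qed

lemma bracket_space_graded:
  "bracket_space (2 * p) (graded_part p g) (graded_part p g') \<subseteq>
    (graded_part p (g \<otimes>\<^bsub>Z2_power (p - 1)\<^esub> g') :: 'a::field mat set)"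
  by (rule bracket_space_subset[OF mat_subspace_graded_part lie_bracket_graded])

text \<open>No entry of a matrix has such a degree. This accounts for the vanishing brackets.\<close>

lemma graded_part_trivial:
  assumes "g \<noteq> \<one>\<^bsub>Z2_power (p - 1)\<^esub>" "g \<notin> Gamma_set p"
  shows "graded_part p g \<subseteq> {0\<^sub>m (2 * p) (2 * p) :: 'a::field mat}"
proof
  fix A :: "'a mat" assume A: "A \<in> graded_part p g"
  then have c: "A \<in> carrier_mat (2 * p) (2 * p)"
    by (auto simp: graded_part_def dest: r_alg_carrier)
  have "A $$ (a, b) = 0" if "a < 2 * p" "b < 2 * p" for a b
    using entry_degree_cases[OF that] assms A that by (auto simp: graded_part_def)
  then show "A \<in> {0\<^sub>m (2 * p) (2 * p)}" using c by (auto simp: mat_eq_iff)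
qed

definition graded_component :: "nat \<Rightarrow> (nat \<Rightarrow> int) \<Rightarrow> 'a::zero mat \<Rightarrow> 'a mat" where
  "graded_component p g A =
     mat (2 * p) (2 * p) (\<lambda>(a, b). if entry_degree p a b = g then A $$ (a, b) else 0)"

lemma graded_component_in_graded_part:
  assumes "A \<in> r_alg p"
  shows "graded_component p g A \<in> (graded_part p g :: 'a::field mat set)"
proof -
  note rA = iffD1[OF r_alg_iff[OF r_alg_carrier[OF assms]] assms, rule_format]
  have "graded_component p g A \<in> carrier_mat (2 * p) (2 * p)"
    by (simp add: graded_component_def)
  moreover have "parity_sign a * graded_component p g A $$ (partner a, b) =
      parity_sign b * graded_component p g A $$ (partner b, a)"
    if "a < 2 * p" "b < 2 * p" for a b
    using that rA block_degree_commute[of p "a div 2 + 1" "b div 2 + 1"]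
    by (simp add: graded_component_def)
  ultimately have "graded_component p g A \<in> r_alg p"
    by (simp add: r_alg_iff)
  then show ?thesis by (simp add: graded_part_def graded_component_def)
qed

text \<open>At a given entry, only the summand of the right degree can be nonzero, so it is the entry
  of the sum.\<close>

lemma graded_component_unique:
  assumes X: "X \<in> graded_part p \<one>\<^bsub>Z2_power (p - 1)\<^esub>"
    and Y: "\<And>g. g \<in> Gamma_set p \<Longrightarrow> Y g \<in> graded_part p g"
    and A: "A = X + finsum (gl_space TYPE('a::field) (2 * p)) Y (Gamma_set p)"
  shows "X = graded_component p \<one>\<^bsub>Z2_power (p - 1)\<^esub> A"
    and "g \<in> Gamma_set p \<Longrightarrow> Y g = graded_component p g A"
proof -
  have gc: "B \<in> carrier_mat (2 * p) (2 * p)" if "B \<in> graded_part p h" for B :: "'a mat" and h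
    using that by (auto simp: graded_part_def dest: r_alg_carrier)
  have gz: "B $$ (a, b) = 0" if "B \<in> graded_part p h" "a < 2 * p" "b < 2 * p" "entry_degree p a b \<noteq> h"
    for B :: "'a mat" and h a b
    using that by (auto simp: graded_part_def)
  have YP: "Y \<in> Gamma_set p \<rightarrow> carrier_mat (2 * p) (2 * p)" using Y gc by blast
  have entry: "A $$ (a, b) = X $$ (a, b) + (\<Sum>g\<in>Gamma_set p. Y g $$ (a, b))"
    if "a < 2 * p" "b < 2 * p" for a b
    using that index_finsum_mat[OF finite_Gamma_set YP that] A by simp
  show "X = graded_component p \<one>\<^bsub>Z2_power (p - 1)\<^esub> A"
  proof (rule eq_matI)
    fix a b assume "a < dim_row (graded_component p \<one>\<^bsub>Z2_power (p - 1)\<^esub> A)"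
      "b < dim_col (graded_component p \<one>\<^bsub>Z2_power (p - 1)\<^esub> A)"
    then have ab: "a < 2 * p" "b < 2 * p" by (simp_all add: graded_component_def)
    have "(\<Sum>g\<in>Gamma_set p. Y g $$ (a, b)) = 0"
      if "entry_degree p a b = \<one>\<^bsub>Z2_power (p - 1)\<^esub>"
      using gz[OF Y ab] that one_notin_Gamma_set by (intro sum.neutral) metis
    then show "X $$ (a, b) = graded_component p \<one>\<^bsub>Z2_power (p - 1)\<^esub> A $$ (a, b)"
      using ab entry[OF ab] gz[OF X ab] by (auto simp: graded_component_def)
  qed (use gc[OF X] in \<open>auto simp: graded_component_def\<close>)
  assume g: "g \<in> Gamma_set p"
  show "Y g = graded_component p g A"
  proof (rule eq_matI)
    fix a b assume "a < dim_row (graded_component p g A)" "b < dim_col (graded_component p g A)"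
    then have ab: "a < 2 * p" "b < 2 * p" by (simp_all add: graded_component_def)
    show "Y g $$ (a, b) = graded_component p g A $$ (a, b)"
    proof (cases "entry_degree p a b = g")
      case True
      have "X $$ (a, b) = 0" using gz[OF X ab] True g one_notin_Gamma_set by metis
      moreover have "(\<Sum>h\<in>Gamma_set p. Y h $$ (a, b)) = (\<Sum>h\<in>Gamma_set p. if h = g then Y g $$ (a, b) else 0)"
        using gz[OF Y ab] True by (intro sum.cong) auto
      ultimately show ?thesis
        using ab entry[OF ab] True g finite_Gamma_set by (simp add: graded_component_def)
    next
      case False
      then show ?thesis using gz[OF Y[OF g] ab] ab by (simp add: graded_component_def)
    qed
  qed (use gc[OF Y[OF g]] in \<open>auto simp: graded_component_def\<close>)
qed

lemma sum_of_graded_components: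
  assumes "A \<in> carrier_mat (2 * p) (2 * p)"
  shows "A = graded_component p \<one>\<^bsub>Z2_power (p - 1)\<^esub> A +
    finsum (gl_space TYPE('a::field) (2 * p)) (\<lambda>g\<in>Gamma_set p. graded_component p g A) (Gamma_set p)"
    (is "_ = ?X + finsum _ ?Y _")
proof (rule eq_matI)
  have YP: "?Y \<in> Gamma_set p \<rightarrow> carrier_mat (2 * p) (2 * p)" by (auto simp: graded_component_def)
  have F: "finsum (gl_space TYPE('a) (2 * p)) ?Y (Gamma_set p) \<in> carrier_mat (2 * p) (2 * p)"
  proof -
    interpret vectorspace class_ring "gl_space TYPE('a) (2 * p)" by (rule matrix_vs)
    show ?thesis using finsum_closed[of ?Y "Gamma_set p"] YP by (simp add: module_mat_simps)
  qed
  then show "dim_row A = dim_row (?X + finsum (gl_space TYPE('a) (2 * p)) ?Y (Gamma_set p))"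
    "dim_col A = dim_col (?X + finsum (gl_space TYPE('a) (2 * p)) ?Y (Gamma_set p))"
    using assms by auto
  fix a b assume "a < dim_row (?X + finsum (gl_space TYPE('a) (2 * p)) ?Y (Gamma_set p))"
    "b < dim_col (?X + finsum (gl_space TYPE('a) (2 * p)) ?Y (Gamma_set p))"
  then have ab: "a < 2 * p" "b < 2 * p" using F by auto
  have "(\<Sum>g\<in>Gamma_set p. ?Y g $$ (a, b)) =
      (\<Sum>g\<in>Gamma_set p. if g = entry_degree p a b then A $$ (a, b) else 0)"
    using ab by (intro sum.cong) (auto simp: graded_component_def)
  also have "\<dots> = (if entry_degree p a b \<in> Gamma_set p then A $$ (a, b) else 0)"
    using finite_Gamma_set by simp
  finally have "(?X + finsum (gl_space TYPE('a) (2 * p)) ?Y (Gamma_set p)) $$ (a, b) =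
      (if entry_degree p a b = \<one>\<^bsub>Z2_power (p - 1)\<^esub> then A $$ (a, b) else 0) +
      (if entry_degree p a b \<in> Gamma_set p then A $$ (a, b) else 0)"
    using ab F index_finsum_mat[OF finite_Gamma_set YP ab] by (simp add: graded_component_def)
  then show "A $$ (a, b) = (?X + finsum (gl_space TYPE('a) (2 * p)) ?Y (Gamma_set p)) $$ (a, b)"
    using entry_degree_cases[OF ab] one_notin_Gamma_set by auto
qed

lemma is_direct_sum_r_alg:
  "is_direct_sum (2 * p) (r_alg p :: 'a::field mat set) (h_alg p) (Gamma_set p) (m_alg p)"
  unfolding is_direct_sum_def
proof (intro conjI ballI)
  show "mat_subspace (2 * p) (r_alg p :: 'a mat set)" by (rule mat_subspace_r_alg)
  show "mat_subspace (2 * p) (h_alg p :: 'a mat set)"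
    unfolding graded_part_one[symmetric] by (rule mat_subspace_graded_part)
  show "h_alg p \<subseteq> (r_alg p :: 'a mat set)" by (auto simp: h_alg_def)
  show "finite (Gamma_set p)" by (rule finite_Gamma_set)
next
  fix g assume g: "g \<in> Gamma_set p"
  show "mat_subspace (2 * p) (m_alg p g :: 'a mat set)"
    unfolding graded_part_Gamma[OF g, symmetric] by (rule mat_subspace_graded_part)
  show "m_alg p g \<subseteq> (r_alg p :: 'a mat set)"
    unfolding graded_part_Gamma[OF g, symmetric] by (auto simp: graded_part_def)
next
  fix A :: "'a mat" assume A: "A \<in> r_alg p"
  let ?X = "graded_component p \<one>\<^bsub>Z2_power (p - 1)\<^esub> A"
  let ?Y = "\<lambda>g\<in>Gamma_set p. graded_component p g A"
  show "\<exists>!(X, Y). X \<in> h_alg p \<and> Y \<in> Pi\<^sub>E (Gamma_set p) (m_alg p) \<and>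
      A = X + finsum (gl_space TYPE('a) (2 * p)) Y (Gamma_set p)"
  proof (rule ex1I[of _ "(?X, ?Y)"])
    have "?X \<in> h_alg p"
      using graded_component_in_graded_part[OF A] graded_part_one by metis
    moreover have "?Y \<in> Pi\<^sub>E (Gamma_set p) (m_alg p)"
      using graded_component_in_graded_part[OF A] graded_part_Gamma by auto
    moreover have "A = ?X + finsum (gl_space TYPE('a) (2 * p)) ?Y (Gamma_set p)"
      by (rule sum_of_graded_components[OF r_alg_carrier[OF A]])
    ultimately show "case (?X, ?Y) of (X, Y) \<Rightarrow> X \<in> h_alg p \<and> Y \<in> Pi\<^sub>E (Gamma_set p) (m_alg p) \<and>
        A = X + finsum (gl_space TYPE('a) (2 * p)) Y (Gamma_set p)"
      by (simp only: prod.case)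
  next
    fix XY :: "'a mat \<times> ((nat \<Rightarrow> int) \<Rightarrow> 'a mat)"
    assume a: "case XY of (X, Y) \<Rightarrow> X \<in> h_alg p \<and> Y \<in> Pi\<^sub>E (Gamma_set p) (m_alg p) \<and>
      A = X + finsum (gl_space TYPE('a) (2 * p)) Y (Gamma_set p)"
    obtain X Y where XY: "XY = (X, Y)" by fastforce
    have X: "X \<in> graded_part p \<one>\<^bsub>Z2_power (p - 1)\<^esub>" using a by (simp only: XY prod.case graded_part_one)
    have Y: "Y g \<in> graded_part p g" if "g \<in> Gamma_set p" for g
      using a that by (auto simp: XY graded_part_Gamma)
    have e: "A = X + finsum (gl_space TYPE('a) (2 * p)) Y (Gamma_set p)" using a by (simp add: XY)
    have "Y \<in> extensional (Gamma_set p)" using a by (simp add: XY PiE_def)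
    then have "Y = ?Y"
      using graded_component_unique(2)[OF X Y e] by (auto simp: extensional_def restrict_def)
    then show "XY = (?X, ?Y)" using graded_component_unique(1)[OF X Y e] by (simp add: XY)
  qed
qed

section \<open>Block-diagonal matrices\<close>

lemma same_block_iff: "a div 2 = b div 2 \<longleftrightarrow> b = a \<or> b = partner a" for a b :: nat
  by (auto simp: partner_def elim!: oddE evenE)

lemma partner_neq [simp]: "partner a \<noteq> a" "a \<noteq> partner a"
  by (auto simp: partner_def elim!: oddE)

lemma sum_lessThan_2: "(\<Sum>i<(2::nat). f i) = f 0 + f 1"
  by (simp add: numeral_2_eq_2)

lemma mult_carrier_square [simp]:
  "A \<in> carrier_mat n n \<Longrightarrow> B \<in> carrier_mat n n \<Longrightarrow> A * B \<in> carrier_mat n n"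
  by (rule mult_carrier_mat)

lemma sum_block:
  assumes "a < 2 * p" "\<And>c. c < 2 * p \<Longrightarrow> c div 2 \<noteq> a div 2 \<Longrightarrow> f c = 0"
  shows "(\<Sum>c<2 * p. f c) = f a + (f (partner a) :: 'a::comm_monoid_add)"
proof -
  have "(\<Sum>c<2 * p. f c) = (\<Sum>c\<in>{a, partner a}. f c)"
  proof (rule sum.mono_neutral_right)
    show "\<forall>c\<in>{..<2 * p} - {a, partner a}. f c = 0"
      using assms(2) same_block_iff[of a] by (metis Diff_iff insert_iff lessThan_iff)
  qed (use assms(1) in auto)
  then show ?thesis by simp
qed

definition block_diagonal :: "nat \<Rightarrow> 'a::zero mat set" where
  "block_diagonal p = {A \<in> carrier_mat (2 * p) (2 * p).
     \<forall>a<2 * p. \<forall>b<2 * p. a div 2 \<noteq> b div 2 \<longrightarrow> A $$ (a, b) = 0}"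

lemma block_diagonal_iff_blocks:
  "A \<in> block_diagonal p \<longleftrightarrow>
    A \<in> carrier_mat (2 * p) (2 * p) \<and> blocks_vanish_outside p {(i, i) | i. True} A"
  by (auto simp: block_diagonal_def blocks_vanish_outside_iff)

text \<open>For a block-diagonal matrix, the equation of \<open>r_alg p\<close> at \<open>(a, b)\<close> reads \<open>0 = 0\<close> if \<open>a\<close>
  and \<open>b\<close> belong to different blocks and is a tautology if \<open>a = b\<close>; for \<open>b = partner a\<close> it says
  that the block has trace zero.\<close>

lemma h_alg_iff:
  "A \<in> h_alg p \<longleftrightarrow> A \<in> block_diagonal p \<and>
    (\<forall>a<2 * p. A $$ (a, a) + A $$ (partner a, partner a) = (0 :: 'a::field))"
proof -
  have "A \<in> r_alg p \<longleftrightarrow> (\<forall>a<2 * p. A $$ (a, a) + A $$ (partner a, partner a) = 0)"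
    if A: "A \<in> block_diagonal p"
  proof -
    have c: "A \<in> carrier_mat (2 * p) (2 * p)" using A by (simp add: block_diagonal_def)
    have z: "A $$ (a, b) = 0" if "a < 2 * p" "b < 2 * p" "a div 2 \<noteq> b div 2" for a b
      using A that by (simp add: block_diagonal_def)
    have "parity_sign a * A $$ (partner a, b) = parity_sign b * A $$ (partner b, a) \<longleftrightarrow>
        (b = partner a \<longrightarrow> A $$ (a, a) + A $$ (partner a, partner a) = 0)"
      if "a < 2 * p" "b < 2 * p" for a b
    proof (cases "a div 2 = b div 2")
      case True
      then consider "b = a" | "b = partner a" by (auto simp: same_block_iff)
      moreover have "parity_sign a * x = - parity_sign a * y \<longleftrightarrow> y + x = 0" for x y :: 'a
        by (auto simp: parity_sign_def add_eq_0_iff)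
      ultimately show ?thesis by cases simp_all
    qed (use that z[of "partner a" b] z[of "partner b" a] in auto)
    then show ?thesis unfolding r_alg_iff[OF c] by (metis partner_less)
  qed
  then show ?thesis
    by (auto simp: h_alg_def block_diagonal_iff_blocks dest: r_alg_carrier)
qed

lemma block_index:
  "x < 2 \<Longrightarrow> y < 2 \<Longrightarrow> block A i j $$ (x, y) = A $$ (2 * (i - 1) + x, 2 * (j - 1) + y)"
  by (simp add: block_def)

lemma block_carrier [simp]: "block A i j \<in> carrier_mat 2 2"
  by (simp add: block_def)

lemma block_dim [simp]: "dim_row (block A i j) = 2" "dim_col (block A i j) = 2"
  by (simp_all add: block_def)

lemma block_mult:
  assumes A: "A \<in> block_diagonal p" and B: "B \<in> carrier_mat (2 * p) (2 * p)" and i: "i \<in> {1..p}"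
  shows "block (A * B) i i = block A i i * (block B i i :: 'a::comm_ring_1 mat)"
proof (rule eq_matI)
  fix x y assume "x < dim_row (block A i i * block B i i)" "y < dim_col (block A i i * block B i i)"
  then have xy: "x < 2" "y < 2" by auto
  define k where "k = 2 * (i - 1)"
  have lt: "k + x < 2 * p" "k + y < 2 * p" "k < 2 * p" and p: "partner k = k + 1"
    and k: "(k + x) div 2 = k div 2" "(k + y) div 2 = k div 2"
    using xy i by (auto simp: partner_def k_def)
  have "(A * B) $$ (k + x, k + y) = (\<Sum>c<2 * p. A $$ (k + x, c) * B $$ (c, k + y))"
    using A B lt by (auto simp: block_diagonal_def scalar_prod_def atLeast0LessThan intro!: sum.cong)
  also have "\<dots> = A $$ (k + x, k) * B $$ (k, k + y) + A $$ (k + x, k + 1) * B $$ (k + 1, k + y)"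
    using lt k A by (subst sum_block[of k]) (auto simp: p block_diagonal_def)
  finally show "block (A * B) i i $$ (x, y) = (block A i i * block B i i) $$ (x, y)"
    using xy by (simp add: block_index scalar_prod_def k_def numeral_2_eq_2)
qed (simp_all)

lemma lie_iso_product_h_alg:
  "lie_iso_product (diagonal_blocks p) (h_alg p :: 'a::field mat set) {1..p} (\<lambda>_. sl_alg 2)"
proof -
  have bd: "A \<in> block_diagonal p" "A \<in> carrier_mat (2 * p) (2 * p)" if "A \<in> h_alg p" for A :: "'a mat"
    using that by (auto simp: h_alg_iff block_diagonal_def)
  have in_range: "2 * (i - 1) + x < 2 * p" if "i \<in> {1..p}" "x < 2" for i x :: nat
    using that by auto
  define assemble :: "(nat \<Rightarrow> 'a mat) \<Rightarrow> 'a mat" where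
    "assemble f = mat (2 * p) (2 * p) (\<lambda>(a, b). if a div 2 = b div 2
       then f (a div 2 + 1) $$ (a mod 2, b mod 2) else 0)" for f
  have bij: "bij_betw (diagonal_blocks p) (h_alg p :: 'a mat set) (Pi\<^sub>E {1..p} (\<lambda>_. sl_alg 2))"
  proof (rule bij_betwI)
    show "diagonal_blocks p \<in> (h_alg p :: 'a mat set) \<rightarrow> Pi\<^sub>E {1..p} (\<lambda>_. sl_alg 2)"
    proof
      fix A :: "'a mat" assume A: "A \<in> h_alg p"
      have "block A i i \<in> sl_alg 2" if i: "i \<in> {1..p}" for i
      proof -
        have "2 * (i - 1) < 2 * p" "partner (2 * (i - 1)) = 2 * (i - 1) + 1"
          using i by (auto simp: partner_def)
        then have "A $$ (2 * (i - 1), 2 * (i - 1)) + A $$ (2 * (i - 1) + 1, 2 * (i - 1) + 1) = 0"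
          using A unfolding h_alg_iff by metis
        then show ?thesis by (simp add: sl_alg_def block_index sum_lessThan_2)
      qed
      then show "diagonal_blocks p A \<in> Pi\<^sub>E {1..p} (\<lambda>_. sl_alg 2)"
        by (auto simp: diagonal_blocks_def)
    qed
    show "assemble \<in> Pi\<^sub>E {1..p} (\<lambda>_. sl_alg 2) \<rightarrow> h_alg p"
    proof
      fix f assume f: "f \<in> Pi\<^sub>E {1..p} (\<lambda>_. sl_alg 2 :: 'a mat set)"
      have "assemble f $$ (a, a) + assemble f $$ (partner a, partner a) = 0" if a: "a < 2 * p" for a
      proof -
        have "f (a div 2 + 1) \<in> sl_alg 2" using f block_number_in_range[OF a] by blast
        then have "f (a div 2 + 1) $$ (0, 0) + f (a div 2 + 1) $$ (1, 1) = 0"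
          by (simp add: sl_alg_def sum_lessThan_2)
        moreover have "a mod 2 = 0 \<and> partner a mod 2 = 1 \<or> a mod 2 = 1 \<and> partner a mod 2 = 0"
          by (auto simp: partner_def elim!: oddE)
        ultimately show ?thesis using a by (auto simp: assemble_def add.commute)
      qed
      then show "assemble f \<in> h_alg p" by (simp add: h_alg_iff block_diagonal_def assemble_def)
    qed
    show "assemble (diagonal_blocks p A) = A" if A: "A \<in> h_alg p" for A
    proof (rule eq_matI)
      fix a b assume "a < dim_row A" "b < dim_col A"
      then have ab: "a < 2 * p" "b < 2 * p" using bd(2)[OF A] by auto
      then have "a div 2 < p" "b div 2 < p" by auto
      moreover have "2 * (b div 2) + b mod 2 = b" "2 * (a div 2) + a mod 2 = a" by simp_all
      ultimately show "assemble (diagonal_blocks p A) $$ (a, b) = A $$ (a, b)"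
        using ab bd(1)[OF A]
        by (cases "a div 2 = b div 2") (simp_all add: assemble_def diagonal_blocks_def block_index block_diagonal_def)
    qed (use bd(2)[OF A] in \<open>auto simp: assemble_def\<close>)
    show "diagonal_blocks p (assemble f) = f"
      if f: "f \<in> Pi\<^sub>E {1..p} (\<lambda>_. sl_alg 2)" for f
    proof
      fix i
      show "diagonal_blocks p (assemble f) i = f i"
      proof (cases "i \<in> {1..p}")
        case True
        have "block (assemble f) i i = f i"
        proof (rule eq_matI)
          have "f i \<in> sl_alg 2" using f True by blast
          then have d: "dim_row (f i) = 2" "dim_col (f i) = 2" by (auto simp: sl_alg_def)
          fix x y assume "x < dim_row (f i)" "y < dim_col (f i)"
          then have xy: "x < 2" "y < 2" using d by auto
          have "(2 * (i - 1) + x) div 2 + 1 = i" "(2 * (i - 1) + y) div 2 + 1 = i"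
            "(2 * (i - 1) + x) mod 2 = x" "(2 * (i - 1) + y) mod 2 = y"
            using xy True by auto
          then show "block (assemble f) i i $$ (x, y) = f i $$ (x, y)"
            using xy in_range[OF True] by (simp add: block_index assemble_def)
        qed (use f True in \<open>auto simp: sl_alg_def PiE_iff\<close>)
        then show ?thesis using True by (simp add: diagonal_blocks_def)
      next
        case False
        then show ?thesis using f by (auto simp: diagonal_blocks_def PiE_iff extensional_def)
      qed
    qed
  qed
  have add: "block (A + B) i i = block A i i + block B i i" and
    minus: "block (A - B) i i = block A i i - block B i i" and
    smult: "block (c \<cdot>\<^sub>m A) i i = c \<cdot>\<^sub>m block A i i"
    if "A \<in> carrier_mat (2 * p) (2 * p)" "B \<in> carrier_mat (2 * p) (2 * p)" "i \<in> {1..p}"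
    for A B :: "'a mat" and i c
    using that in_range[OF that(3)]
    by (auto intro!: eq_matI simp: block_index)
  have bracket: "block (lie_bracket A B) i i = lie_bracket (block A i i) (block B i i)"
    if "A \<in> h_alg p" "B \<in> h_alg p" "i \<in> {1..p}" for A B :: "'a mat" and i
  proof -
    note c = bd(2)[OF that(1)] bd(2)[OF that(2)]
    have "A * B \<in> carrier_mat (2 * p) (2 * p)" "B * A \<in> carrier_mat (2 * p) (2 * p)"
      using c by auto
    then show ?thesis
      using minus[OF _ _ that(3), of "A * B" "B * A"]
        block_mult[OF bd(1)[OF that(1)] c(2) that(3)] block_mult[OF bd(1)[OF that(2)] c(1) that(3)]
      by (simp add: lie_bracket_def)
  qed
  show ?thesis
    unfolding lie_iso_product_def
    using bij add[OF bd(2) bd(2)] smult[OF bd(2) bd(2)] bracket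
    by (auto simp: diagonal_blocks_def fun_eq_iff restrict_def)
qed

section \<open>The symplectic group and its sign automorphisms\<close>

lemma det_mat_2:
  assumes "A \<in> carrier_mat 2 2"
  shows "det A = A $$ (0, 0) * A $$ (1, 1) - A $$ (0, 1) * (A $$ (1, 0) :: 'a::comm_ring_1)"
proof -
  have "det A = (\<Sum>j<2. A $$ (0, j) * cofactor A 0 j)"
    by (rule laplace_expansion_row[OF assms]) simp
  moreover have "det (mat_delete A 0 0) = A $$ (1, 1)" "det (mat_delete A 0 1) = A $$ (1, 0)"
    using assms by (subst det_single, auto simp: mat_delete_def)+
  ultimately show ?thesis by (simp add: cofactor_def sum_lessThan_2)
qed

lemma carrier_GL: "carrier (GL TYPE('a::field) n) = Units (ring_mat TYPE('a) n ())"
  by (simp add: units_of_def)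

lemma carrier_GL_subset: "A \<in> carrier (GL TYPE('a::field) n) \<Longrightarrow> A \<in> carrier_mat n n"
  by (auto simp: units_of_def Units_def ring_mat_def)

lemma group_GL: "group (GL TYPE('a::field) n)"
proof -
  interpret ring "ring_mat TYPE('a) n ()" by (rule ring_mat)
  show ?thesis by (rule units_group)
qed

lemma GL_simps [simp]:
  "mult (GL TYPE('a::field) n) = (*)" "one (GL TYPE('a) n) = 1\<^sub>m n"
  by (simp_all add: units_of_def ring_mat_simps)

lemma R_group_simps [simp]:
  "mult (R_group p :: 'a::field mat monoid) = (*)" "one (R_group p :: 'a mat monoid) = 1\<^sub>m (2 * p)"
  by (simp_all add: R_group_def)

text \<open>A matrix preserving \<open>\<Theta>\<close> is automatically invertible, because \<open>\<Theta>\<^sup>2 = -1\<close> makes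
  \<open>- \<Theta> A\<^sup>T \<Theta>\<close> an inverse.\<close>

lemma R_group_iff:
  "A \<in> carrier (R_group p) \<longleftrightarrow> A \<in> carrier_mat (2 * p) (2 * p) \<and>
    transpose_mat A * Theta p * A = (Theta p :: 'a::field mat)"
proof (intro iffI conjI)
  assume a: "A \<in> carrier_mat (2 * p) (2 * p) \<and> transpose_mat A * Theta p * A = Theta p"
  let ?B = "- (Theta p * (transpose_mat A * Theta p))"
  have c: "A \<in> carrier_mat (2 * p) (2 * p)" "?B \<in> carrier_mat (2 * p) (2 * p)" using a by auto
  have "?B * A = - (Theta p * (transpose_mat A * Theta p) * A)"
    using c by simp
  also have "\<dots> = - (Theta p * (transpose_mat A * Theta p * A))"
    using c by (subst assoc_mult_mat[of _ "2*p" "2*p" _ "2*p" _ "2*p"]) auto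
  also have "\<dots> = 1\<^sub>m (2 * p)" using a by (simp add: Theta_Theta)
  finally have "?B * A = 1\<^sub>m (2 * p)" .
  then have "A \<in> Units (ring_mat TYPE('a) (2 * p) ())"
    using c mat_mult_left_right_inverse[OF c(2,1)] unfolding Units_def ring_mat_simps by blast
  then show "A \<in> carrier (R_group p)" using a by (simp add: R_group_def carrier_GL)
qed (auto simp: R_group_def dest: carrier_GL_subset)

lemma carrier_R_group: "A \<in> carrier (R_group p) \<Longrightarrow> A \<in> carrier_mat (2 * p) (2 * p)"
  by (simp add: R_group_iff)

lemma subgroup_R_group: "subgroup (carrier (R_group p)) (GL TYPE('a::field) (2 * p))"
proof -
  interpret G: group "GL TYPE('a) (2 * p)" by (rule group_GL)
  let ?T = "Theta p :: 'a mat"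
  have form_mult: "transpose_mat (A * B) * ?T * (A * B) = transpose_mat B * (transpose_mat A * ?T * A) * B"
    if "A \<in> carrier_mat (2 * p) (2 * p)" "B \<in> carrier_mat (2 * p) (2 * p)" for A B :: "'a mat"
    using that by (simp add: transpose_mult[OF that] assoc_mult_mat[of _ "2*p" "2*p" _ "2*p" _ "2*p"])
  show ?thesis
  proof (rule G.subgroupI)
    show "carrier (R_group p) \<subseteq> carrier (GL TYPE('a) (2 * p))" by (auto simp: R_group_def)
    have "1\<^sub>m (2 * p) \<in> carrier (R_group p :: 'a mat monoid)" by (simp add: R_group_iff)
    then show "carrier (R_group p) \<noteq> ({} :: 'a mat set)" by blast
  next
    fix A B :: "'a mat" assume "A \<in> carrier (R_group p)" "B \<in> carrier (R_group p)"
    then show "A \<otimes>\<^bsub>GL TYPE('a) (2 * p)\<^esub> B \<in> carrier (R_group p)"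
      using form_mult[of A B] by (simp add: R_group_iff)
  next
    fix A :: "'a mat" assume A: "A \<in> carrier (R_group p)"
    then have AG: "A \<in> carrier (GL TYPE('a) (2 * p))" by (simp add: R_group_def)
    let ?B = "inv\<^bsub>GL TYPE('a) (2 * p)\<^esub> A"
    have B: "?B \<in> carrier_mat (2 * p) (2 * p)" using G.inv_closed[OF AG] carrier_GL_subset by blast
    have "A * ?B = 1\<^sub>m (2 * p)" using G.r_inv[OF AG] by simp
    then have "transpose_mat ?B * ?T * ?B = transpose_mat (1\<^sub>m (2 * p)) * ?T * 1\<^sub>m (2 * p)"
      using form_mult[of A ?B] A B by (simp add: R_group_iff)
    then show "?B \<in> carrier (R_group p)" using B by (simp add: R_group_iff)
  qed
qed

lemma group_R_group: "group (R_group p :: 'a::field mat monoid)"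
proof -
  have "R_group p = (GL TYPE('a) (2 * p))\<lparr>carrier := carrier (R_group p)\<rparr>"
    by (simp add: R_group_def)
  then show ?thesis
    using group.subgroup_imp_group[OF group_GL subgroup_R_group] by metis
qed

text \<open>The two columns of a \<open>2 \<times> 2\<close> matrix pair to its determinant: for block-diagonal \<open>A\<close>, the
  entry of \<open>A\<^sup>T \<Theta> A\<close> at \<open>(a, partner a)\<close> is, up to sign, the determinant of the block of \<open>a\<close>, and
  the entries elsewhere vanish as they do for \<open>\<Theta>\<close>.\<close>

lemma H_group_eq: "H_group p = (carrier (R_group p) \<inter> block_diagonal p :: 'a::field mat set)"
proof -
  have "A \<in> H_group p \<longleftrightarrow> A \<in> carrier (R_group p)" if A: "A \<in> block_diagonal p" for A :: "'a mat"
  proof -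
    have c: "A \<in> carrier_mat (2 * p) (2 * p)" using A by (simp add: block_diagonal_def)
    have z: "A $$ (a, b) = 0" if "a < 2 * p" "b < 2 * p" "a div 2 \<noteq> b div 2" for a b
      using A that by (simp add: block_diagonal_def)
    define d where "d a = A $$ (a, a) * A $$ (partner a, partner a) - A $$ (partner a, a) * A $$ (a, partner a)" for a
    have form: "(transpose_mat A * Theta p * A) $$ (a, b) = (if b = partner a then parity_sign a * d a else 0)"
      if ab: "a < 2 * p" "b < 2 * p" for a b
    proof -
      have "(transpose_mat A * Theta p * A) $$ (a, b) =
          parity_sign a * A $$ (a, a) * A $$ (partner a, b) - parity_sign a * A $$ (partner a, a) * A $$ (a, b)"
        using ab z by (simp add: symplectic_form_index[OF c ab] sum_block[of a] del: index_mult_mat(1))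
      also have "\<dots> = (if b = partner a then parity_sign a * d a else 0)"
      proof (cases "a div 2 = b div 2")
        case True
        then consider "b = a" | "b = partner a" by (auto simp: same_block_iff)
        then show ?thesis by cases (auto simp: d_def algebra_simps)
      qed (use ab z in auto)
      finally show ?thesis .
    qed
    have "transpose_mat A * Theta p * A = Theta p \<longleftrightarrow>
        (\<forall>a<2 * p. \<forall>b<2 * p. (transpose_mat A * Theta p * A) $$ (a, b) = Theta p $$ (a, b))"
      using c by (subst mat_eq_iff) auto
    also have "\<dots> \<longleftrightarrow> (\<forall>a<2 * p. d a = 1)"
    proof -
      have "parity_sign a * d a = parity_sign a \<longleftrightarrow> d a = 1" for a
        by (auto simp: parity_sign_def)
      then have "(transpose_mat A * Theta p * A) $$ (a, b) = Theta p $$ (a, b) \<longleftrightarrow> (b = partner a \<longrightarrow> d a = 1)"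
        if "a < 2 * p" "b < 2 * p" for a b
        using that by (simp add: form Theta_index del: index_mult_mat(1))
      then show ?thesis by (metis partner_less)
    qed
    also have "\<dots> \<longleftrightarrow> (\<forall>i\<in>{1..p}. det (block A i i) = 1)"
    proof -
      have even: "det (block A i i) = d (2 * (i - 1))" for i
        by (simp add: det_mat_2 block_index d_def partner_def)
      have sym: "d (partner a) = d a" for a by (simp add: d_def mult.commute)
      have "d a = det (block A (a div 2 + 1) (a div 2 + 1))" for a
      proof (cases "even a")
        case True
        then show ?thesis by (simp add: even)
      next
        case False
        then have "2 * (a div 2) = partner a" by (auto simp: partner_def elim!: oddE)
        then show ?thesis by (simp add: even sym)
      qed
      moreover have "\<exists>a<2 * p. i = a div 2 + 1" if "i \<in> {1..p}" for i
        using that by (intro exI[of _ "2 * (i - 1)"]) auto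
      ultimately show ?thesis using block_number_in_range by metis
    qed
    finally show ?thesis using A c
      by (auto simp: H_group_def R_group_iff SL_set_def block_diagonal_iff_blocks)
  qed
  moreover have "H_group p \<subseteq> (block_diagonal p :: 'a mat set)"
    by (auto simp: H_group_def block_diagonal_iff_blocks)
  ultimately show ?thesis by blast
qed

text \<open>For signs \<open>e\<close>, this is \<open>D A D\<^sup>-\<^sup>1\<close>, where \<open>D\<close> is block-diagonal with the scalar blocks \<open>e k\<close>.
  The entrywise form makes the map visibly polynomial; blocks are numbered from 0 here.\<close>

definition sign_conj :: "nat \<Rightarrow> (nat \<Rightarrow> 'a::field) \<Rightarrow> 'a mat \<Rightarrow> 'a mat" where
  "sign_conj p e A = mat (2 * p) (2 * p) (\<lambda>(a, b). e (a div 2) * e (b div 2) * A $$ (a, b))"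

lemma sign_conj_carrier [simp]: "sign_conj p e A \<in> carrier_mat (2 * p) (2 * p)"
  by (simp add: sign_conj_def)

lemma sign_conj_dim [simp]: "dim_row (sign_conj p e A) = 2 * p" "dim_col (sign_conj p e A) = 2 * p"
  by (simp_all add: sign_conj_def)

lemma sign_conj_index [simp]:
  "a < 2 * p \<Longrightarrow> b < 2 * p \<Longrightarrow> sign_conj p e A $$ (a, b) = e (a div 2) * e (b div 2) * A $$ (a, b)"
  by (simp add: sign_conj_def)

lemma sign_conj_mult:
  assumes "\<And>k. e k * e k = 1" "A \<in> carrier_mat (2 * p) (2 * p)" "B \<in> carrier_mat (2 * p) (2 * p)"
  shows "sign_conj p e (A * B) = sign_conj p e A * sign_conj p e B"
proof (rule eq_matI)
  fix a b assume "a < dim_row (sign_conj p e A * sign_conj p e B)" "b < dim_col (sign_conj p e A * sign_conj p e B)"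
  then have ab: "a < 2 * p" "b < 2 * p" by auto
  have "(sign_conj p e A * sign_conj p e B) $$ (a, b) =
      (\<Sum>c<2 * p. (e (a div 2) * e (c div 2) * A $$ (a, c)) * (e (c div 2) * e (b div 2) * B $$ (c, b)))"
    using ab by (auto simp: scalar_prod_def atLeast0LessThan intro!: sum.cong)
  also have "\<dots> = (\<Sum>c<2 * p. e (a div 2) * e (b div 2) * (A $$ (a, c) * B $$ (c, b)))"
  proof (rule sum.cong[OF refl])
    fix c
    have "(e (a div 2) * e (c div 2) * A $$ (a, c)) * (e (c div 2) * e (b div 2) * B $$ (c, b)) =
        (e (c div 2) * e (c div 2)) * (e (a div 2) * e (b div 2) * (A $$ (a, c) * B $$ (c, b)))"
      by (simp add: ac_simps)
    then show "(e (a div 2) * e (c div 2) * A $$ (a, c)) * (e (c div 2) * e (b div 2) * B $$ (c, b)) =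
        e (a div 2) * e (b div 2) * (A $$ (a, c) * B $$ (c, b))"
      by (simp add: assms(1))
  qed
  also have "\<dots> = sign_conj p e (A * B) $$ (a, b)"
    using ab assms(2,3) by (auto simp: scalar_prod_def atLeast0LessThan sum_distrib_left intro!: sum.cong)
  finally show "sign_conj p e (A * B) $$ (a, b) = (sign_conj p e A * sign_conj p e B) $$ (a, b)" by simp
qed simp_all

lemma sign_conj_in_R_group:
  assumes e: "\<And>k. e k * e k = 1" and A: "A \<in> carrier (R_group p)"
  shows "sign_conj p e A \<in> carrier (R_group p)"
proof -
  have c: "A \<in> carrier_mat (2 * p) (2 * p)" and f: "transpose_mat A * Theta p * A = Theta p"
    using A by (auto simp: R_group_iff)
  have "transpose_mat (sign_conj p e A) = sign_conj p e (transpose_mat A)"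
    using c by (auto intro!: eq_matI)
  moreover have T: "sign_conj p e (Theta p) = Theta p"
    by (rule eq_matI) (auto simp: Theta_index e)
  ultimately have "transpose_mat (sign_conj p e A) * Theta p * sign_conj p e A =
      sign_conj p e (transpose_mat A) * sign_conj p e (Theta p) * sign_conj p e A"
    by simp
  also have "\<dots> = sign_conj p e (transpose_mat A * Theta p * A)"
    using c by (simp add: sign_conj_mult[of e, OF e])
  finally show ?thesis by (simp add: f T R_group_iff)
qed

lemma sign_conj_sign_conj:
  "sign_conj p e (sign_conj p f A) = sign_conj p (\<lambda>k. e k * f k) A"
  by (rule eq_matI) auto

lemma sign_conj_one: "A \<in> carrier_mat (2 * p) (2 * p) \<Longrightarrow> sign_conj p (\<lambda>_. 1) A = A"
  by (intro eq_matI) auto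

text \<open>Opposite choices of all signs give the same conjugation, so the sign of the block numbered 0
  is normalised to 1; the remaining signs then depend on \<open>s\<close> faithfully.\<close>

definition block_signs :: "(nat \<Rightarrow> int) \<Rightarrow> nat \<Rightarrow> 'a::ring_1" where
  "block_signs s k = (if k = 0 \<or> s k = 0 then 1 else - 1)"

lemma block_signs_square [simp]: "block_signs s k * block_signs s k = 1"
  by (simp add: block_signs_def)

lemma block_signs_mult:
  assumes "s \<in> carrier (Z2_power (p - 1))" "t \<in> carrier (Z2_power (p - 1))" "k < p"
  shows "block_signs (s \<otimes>\<^bsub>Z2_power (p - 1)\<^esub> t) k = (block_signs s k * block_signs t k :: 'a::ring_1)"
proof (cases "k = 0")
  case False
  then have k: "k \<in> {1..p - 1}" using assms(3) by auto
  then have "s k \<in> {0, 1}" "t k \<in> {0, 1}" using assms(1,2) by (auto simp: Z2_power_carrier PiE_iff)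
  then show ?thesis using k by (auto simp: block_signs_def Z2_power_mult)
qed (simp add: block_signs_def)

text \<open>This is \<open>exp N\<close> for \<open>N\<^sup>2 = 0\<close>: the exponential of an element of the Lie algebra lies in the
  group.\<close>

lemma r_alg_one_plus:
  assumes N: "N \<in> r_alg p" and NN: "N * N = 0\<^sub>m (2 * p) (2 * p)"
  shows "1\<^sub>m (2 * p) + N \<in> carrier (R_group p :: 'a::field mat monoid)"
proof -
  note c = r_alg_carrier[OF N]
  let ?n = "2 * p" and ?T = "Theta p :: 'a mat"
  have sq: "transpose_mat N * ?T * N = 0\<^sub>m ?n ?n"
  proof -
    have "transpose_mat N * ?T * N = - (?T * N) * N"
      by (simp add: r_alg_transpose[OF N])
    also have "\<dots> = - (?T * (N * N))"
      using c by (simp add: assoc_mult_mat[of _ ?n ?n _ ?n _ ?n])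
    also have "\<dots> = 0\<^sub>m ?n ?n" by (intro eq_matI) (simp_all add: NN)
    finally show ?thesis .
  qed
  have "transpose_mat (1\<^sub>m ?n + N) * ?T * (1\<^sub>m ?n + N) =
      (?T + transpose_mat N * ?T) * (1\<^sub>m ?n + N)"
    using c by (simp add: transpose_add[of _ ?n ?n] add_mult_distrib_mat[of _ ?n ?n _ _ ?n])
  also have "\<dots> = (?T + transpose_mat N * ?T) + (?T * N + transpose_mat N * ?T * N)"
    using c by (simp add: mult_add_distrib_mat[of _ ?n ?n _ ?n] add_mult_distrib_mat[of _ ?n ?n _ _ ?n])
  also have "\<dots> = ?T"
    unfolding sq unfolding r_alg_transpose[OF N]
    using c by (intro eq_matI) (auto simp del: index_mult_mat(1))
  finally show ?thesis using c by (simp add: R_group_iff)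
qed

text \<open>The action multiplies this entry by the sign of the block numbered \<open>k\<close>, so it detects that
  sign.\<close>

lemma exists_symplectic_entry:
  assumes "0 < k" "k < p"
  shows "\<exists>A \<in> carrier (R_group p). A $$ (0, 2 * k + 1) = (1 :: 'a::field)"
proof -
  \<comment> \<open>\<open>N = (e\<^sub>0 e\<^sub>m\<^sup>T + e\<^sub>m e\<^sub>0\<^sup>T) \<Theta>\<close> with \<open>m = 2 * k\<close>, a symmetric matrix times \<open>\<Theta>\<close>.\<close>
  define N :: "'a mat" where "N = mat (2 * p) (2 * p)
    (\<lambda>(a, b). if a = 0 \<and> b = 2 * k + 1 \<or> a = 2 * k \<and> b = 1 then 1 else 0)"
  have c: "N \<in> carrier_mat (2 * p) (2 * p)" by (simp add: N_def)
  have pt: "partner a = 0 \<longleftrightarrow> a = 1" "partner a = 2 * k \<longleftrightarrow> a = 2 * k + 1" for a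
    using eq_partner_iff[of 0 a] eq_partner_iff[of "2 * k" a] by (auto simp: partner_def)
  have "N \<in> r_alg p"
    unfolding r_alg_iff[OF c] using assms by (auto simp: N_def pt parity_sign_def)
  moreover have "N * N = 0\<^sub>m (2 * p) (2 * p)"
  proof (rule eq_matI)
    fix a b assume ab: "a < dim_row (0\<^sub>m (2 * p) (2 * p) :: 'a mat)" "b < dim_col (0\<^sub>m (2 * p) (2 * p) :: 'a mat)"
    have "N $$ (a, c) * N $$ (c, b) = 0" if "c < 2 * p" for c
      using ab that assms by (auto simp: N_def)
    then show "(N * N) $$ (a, b) = 0\<^sub>m (2 * p) (2 * p) $$ (a, b)"
      using ab c by (auto simp: scalar_prod_def intro!: sum.neutral)
  qed (use c in auto)
  ultimately have "1\<^sub>m (2 * p) + N \<in> carrier (R_group p)" by (rule r_alg_one_plus)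
  moreover have "(1\<^sub>m (2 * p) + N) $$ (0, 2 * k + 1) = 1" using assms by (simp add: N_def)
  ultimately show ?thesis by blast
qed

section \<open>Zariski-closed and classically closed subsets of the general linear group\<close>

lemma topspace_zariski_GL: "topspace (zariski_GL TYPE('a::field) n) = carrier (GL TYPE('a) n)"
proof -
  let ?B = "{{A \<in> carrier (GL TYPE('a) n). f A \<noteq> 0} | f. f \<in> regular_functions n}"
  have "carrier (GL TYPE('a) n) \<in> ?B"
    using regular_functions.const[of "1 :: 'a" n]
    by (intro CollectI exI[of _ "\<lambda>_. 1"]) simp
  then have "\<Union>?B = carrier (GL TYPE('a) n)"
    by (intro subset_antisym Union_upper Union_least) auto
  then show ?thesis by (simp add: zariski_GL_def)
qed

lemma closedin_zariski_zero_set: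
  assumes "F \<subseteq> regular_functions n"
  shows "closedin (zariski_GL TYPE('a::field) n) {A \<in> carrier (GL TYPE('a) n). \<forall>f\<in>F. f A = 0}"
proof -
  have "carrier (GL TYPE('a) n) - {A \<in> carrier (GL TYPE('a) n). \<forall>f\<in>F. f A = 0} =
      (\<Union>f\<in>F. {A \<in> carrier (GL TYPE('a) n). f A \<noteq> 0})" by blast
  moreover have "openin (zariski_GL TYPE('a) n) {A \<in> carrier (GL TYPE('a) n). f A \<noteq> 0}" if "f \<in> F" for f
    unfolding zariski_GL_def using that assms by (intro topology_generated_by_Basis) blast
  ultimately show ?thesis
    by (auto simp: closedin_def topspace_zariski_GL)
qed

lemma regular_functions_sum:
  assumes "finite I" "\<And>c. c \<in> I \<Longrightarrow> f c \<in> regular_functions n"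
  shows "(\<lambda>A. \<Sum>c\<in>I. f c A) \<in> (regular_functions n :: ('a::field mat \<Rightarrow> 'a) set)"
  using assms
proof (induction I rule: finite_induct)
  case empty
  then show ?case using regular_functions.const[of 0 n] by simp
next
  case (insert x I)
  then show ?case using regular_functions.add[of "f x" n "\<lambda>A. \<Sum>c\<in>I. f c A"] by simp
qed

lemma topspace_classical_mat: "topspace (classical_mat n) = carrier_mat n n"
  by (auto simp: classical_mat_def topspace_pullback_topology)

lemma topspace_classical_GL: "topspace (classical_GL n) = carrier (GL TYPE(complex) n)"
  using carrier_GL_subset by (auto simp: classical_GL_def topspace_classical_mat)

lemma entry_continuous:
  assumes "i < n" "j < n"
  shows "continuous_map (classical_GL n) euclidean (\<lambda>A. A $$ (i, j))"
proof -
  have "continuous_map (classical_mat n) euclidean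
      ((\<lambda>x. x (i, j)) \<circ> (\<lambda>A. \<lambda>ij\<in>{..<n} \<times> {..<n}. A $$ ij :: complex))"
    unfolding classical_mat_def
    by (intro continuous_map_pullback continuous_map_product_projection) (use assms in auto)
  then show ?thesis
    using assms by (simp add: o_def classical_GL_def continuous_map_from_subtopology)
qed

lemma regular_function_continuous:
  "f \<in> regular_functions n \<Longrightarrow> continuous_map (classical_GL n) euclidean f"
proof (induction rule: regular_functions.induct)
  case (entry i j)
  then show ?case by (rule entry_continuous)
next
  case inv_det
  have entry: "((\<lambda>A. A $$ (i, j)) \<longlongrightarrow> B $$ (i, j)) (atin (classical_GL n) B)"
    if "i < n" "j < n" "B \<in> topspace (classical_GL n)" for i j and B :: "complex mat"
    using entry_continuous[OF that(1,2)] that(3) by (simp add: continuous_map_atin)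
  let ?d = "\<lambda>A :: complex mat. \<Sum>q | q permutes {0..<n}. signof q * (\<Prod>i = 0..<n. A $$ (i, q i))"
  have d: "det A = ?d A" "det A \<noteq> 0" if "A \<in> topspace (classical_GL n)" for A
  proof -
    have A: "A \<in> carrier (GL TYPE(complex) n)" using that by (simp add: topspace_classical_GL)
    show "det A = ?d A" by (rule det_def'[OF carrier_GL_subset[OF A]])
    show "det A \<noteq> 0" by (rule unit_imp_det_non_zero[OF A[unfolded carrier_GL]])
  qed
  have "continuous_map (classical_GL n) euclidean (\<lambda>A. inverse (?d A))"
    unfolding continuous_map_atin
  proof
    fix B :: "complex mat" assume B: "B \<in> topspace (classical_GL n)"
    have "((\<lambda>A. inverse (?d A)) \<longlongrightarrow> inverse (?d B)) (atin (classical_GL n) B)"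
    proof (intro tendsto_inverse tendsto_sum tendsto_mult tendsto_const tendsto_prod)
      fix q i assume "q \<in> {q. q permutes {0..<n}}" "i \<in> {0..<n}"
      then have "i < n" "q i < n" using permutes_in_image[of q "{0..<n}" i] by auto
      then show "((\<lambda>A. A $$ (i, q i)) \<longlongrightarrow> B $$ (i, q i)) (atin (classical_GL n) B)"
        using entry B by blast
    next
      show "?d B \<noteq> 0" using d[OF B] by simp
    qed
    then show "limitin euclidean (\<lambda>A. inverse (?d A)) (inverse (?d B)) (atin (classical_GL n) B)"
      by simp
  qed
  then show ?case by (rule continuous_map_eq) (simp add: d(1))
next
  case (add f g)
  then show ?case by (simp add: continuous_map_atin tendsto_add)
next
  case (mult f g)
  then show ?case by (simp add: continuous_map_atin tendsto_mult)
qed simp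

text \<open>The classical topology refines the Zariski topology because regular functions are
  continuous. Closedness therefore has to be established only once.\<close>

lemma closedin_zariski_imp_classical:
  assumes "closedin (zariski_GL TYPE(complex) n) S"
  shows "closedin (classical_GL n) S"
proof -
  have "continuous_map (classical_GL n) (zariski_GL TYPE(complex) n) (\<lambda>A. A)"
    unfolding zariski_GL_def
  proof (rule continuous_on_generated_topo)
    fix U assume "U \<in> {{A \<in> carrier (GL TYPE(complex) n). f A \<noteq> 0} |f. f \<in> regular_functions n}"
    then obtain f where f: "f \<in> regular_functions n"
      and U: "U = {A \<in> carrier (GL TYPE(complex) n). f A \<noteq> 0}" by blast
    have "openin (classical_GL n) {A \<in> topspace (classical_GL n). f A \<in> - {0}}"
      by (rule openin_continuous_map_preimage[OF regular_function_continuous[OF f]]) auto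
    moreover have "(\<lambda>A. A) -` U \<inter> topspace (classical_GL n) = {A \<in> topspace (classical_GL n). f A \<in> - {0}}"
      by (auto simp: U topspace_classical_GL)
    ultimately show "openin (classical_GL n) ((\<lambda>A. A) -` U \<inter> topspace (classical_GL n))" by simp
  next
    show "(\<lambda>A. A) ` topspace (classical_GL n) \<subseteq>
        \<Union> {{A \<in> carrier (GL TYPE(complex) n). f A \<noteq> 0} |f. f \<in> regular_functions n}"
      using topspace_zariski_GL[where 'a = complex, of n]
      by (simp add: topspace_classical_GL zariski_GL_def)
  qed
  then have "closedin (classical_GL n) {A \<in> topspace (classical_GL n). A \<in> S}"
    by (rule closedin_continuous_map_preimage) (rule assms)
  moreover have "{A \<in> topspace (classical_GL n). A \<in> S} = S"
    using closedin_subset[OF assms] by (auto simp: topspace_zariski_GL topspace_classical_GL)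
  ultimately show ?thesis by simp
qed

lemma closedin_zariski_R_group:
  "closedin (zariski_GL TYPE('a::field) (2 * p)) (carrier (R_group p))"
proof -
  define form :: "nat \<Rightarrow> nat \<Rightarrow> 'a mat \<Rightarrow> 'a" where
    "form a b = (\<lambda>A. (\<Sum>c<2 * p. parity_sign c * A $$ (c, a) * A $$ (partner c, b)) + - Theta p $$ (a, b))" for a b
  have reg: "form a b \<in> regular_functions (2 * p)" if "a < 2 * p" "b < 2 * p" for a b
    unfolding form_def
    by (intro regular_functions.add regular_functions_sum regular_functions.mult
        regular_functions.const regular_functions.entry) (use that in auto)
  let ?F = "{form a b | a b. a < 2 * p \<and> b < 2 * p}"
  have "A \<in> carrier (R_group p) \<longleftrightarrow> A \<in> carrier (GL TYPE('a) (2 * p)) \<and> (\<forall>f\<in>?F. f A = 0)" for A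
  proof (cases "A \<in> carrier (GL TYPE('a) (2 * p))")
    case True
    then have c: "A \<in> carrier_mat (2 * p) (2 * p)" by (rule carrier_GL_subset)
    have "transpose_mat A * Theta p * A = Theta p \<longleftrightarrow> (\<forall>a<2 * p. \<forall>b<2 * p.
        (transpose_mat A * Theta p * A) $$ (a, b) = Theta p $$ (a, b))"
      using c by (subst mat_eq_iff) auto
    also have "\<dots> \<longleftrightarrow> (\<forall>a<2 * p. \<forall>b<2 * p. form a b A = 0)"
      by (simp add: form_def symplectic_form_index[OF c] del: index_mult_mat(1))
    finally show ?thesis using True by (auto simp: R_group_def)
  qed (auto simp: R_group_def)
  then have "carrier (R_group p) = {A \<in> carrier (GL TYPE('a) (2 * p)). \<forall>f\<in>?F. f A = 0}" by blast
  moreover have "closedin (zariski_GL TYPE('a) (2 * p)) \<dots>"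
    by (rule closedin_zariski_zero_set) (use reg in blast)
  ultimately show ?thesis by simp
qed

lemma closedin_zariski_block_diagonal:
  "closedin (zariski_GL TYPE('a::field) (2 * p)) (carrier (GL TYPE('a) (2 * p)) \<inter> block_diagonal p)"
proof -
  let ?F = "{\<lambda>A :: 'a mat. A $$ (a, b) | a b. a < 2 * p \<and> b < 2 * p \<and> a div 2 \<noteq> b div 2}"
  have "carrier (GL TYPE('a) (2 * p)) \<inter> block_diagonal p =
      {A \<in> carrier (GL TYPE('a) (2 * p)). \<forall>f\<in>?F. f A = 0}"
    by (auto simp: block_diagonal_def dest: carrier_GL_subset)
  moreover have "closedin (zariski_GL TYPE('a) (2 * p)) \<dots>"
    by (rule closedin_zariski_zero_set) (auto intro: regular_functions.entry)
  ultimately show ?thesis by simp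
qed

lemma regular_map_sign_conj:
  assumes "\<And>A. A \<in> X \<Longrightarrow> f A = sign_conj p e A"
  shows "regular_map (2 * p) X (f :: 'a::field mat \<Rightarrow> 'a mat)"
  unfolding regular_map_def
proof (intro allI impI)
  fix i j assume "i < 2 * p" "j < 2 * p"
  then show "\<exists>g\<in>regular_functions (2 * p). \<forall>A\<in>X. f A $$ (i, j) = g A"
    using assms
    by (intro bexI[of _ "\<lambda>A. e (i div 2) * e (j div 2) * A $$ (i, j)"] regular_functions.mult
        regular_functions.const regular_functions.entry) auto
qed

text \<open>The map extends to a linear map of the whole matrix space, which is its own derivative.\<close>

lemma holomorphic_map_sign_conj:
  assumes "\<And>A. A \<in> X \<Longrightarrow> f A = sign_conj p e A" "X \<subseteq> carrier_mat (2 * p) (2 * p)"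
  shows "holomorphic_map (2 * p) X f"
proof -
  have diff: "complex_differentiable_mat (2 * p) (\<lambda>C. sign_conj p e C $$ (i, j)) B"
    if ij: "i < 2 * p" "j < 2 * p" for i j B
  proof -
    define c where "c = e (i div 2) * e (j div 2)"
    have mult_if: "(if P then x else 0) * y = (if P then x * y else 0)" for P and x y :: complex
      by simp
    have "(\<Sum>l<2 * p. (if k = i \<and> l = j then c else 0) * (C $$ (k, l) - B $$ (k, l))) =
        (if k = i then c * (C $$ (i, j) - B $$ (i, j)) else 0)" for C k
      using ij by (cases "k = i") (simp_all add: mult_if)
    then have "(\<Sum>k<2 * p. \<Sum>l<2 * p. (if k = i \<and> l = j then c else 0) * (C $$ (k, l) - B $$ (k, l))) =
        sign_conj p e C $$ (i, j) - sign_conj p e B $$ (i, j)" for C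
      using ij by (simp add: c_def right_diff_distrib)
    then show ?thesis
      unfolding complex_differentiable_mat_def
      by (intro exI[of _ "\<lambda>k l. if k = i \<and> l = j then c else 0"] allI impI exI[of _ 1])
        (auto intro!: mult_nonneg_nonneg sum_nonneg)
  qed
  have "openin (classical_mat (2 * p)) (carrier_mat (2 * p) (2 * p))"
    using openin_topspace[of "classical_mat (2 * p)"] by (simp add: topspace_classical_mat)
  then show ?thesis
    unfolding holomorphic_map_def using assms diff
    by (intro ballI exI[of _ "carrier_mat (2 * p) (2 * p)"] exI[of _ "sign_conj p e"]) auto
qed

section \<open>The symmetric structure\<close>

definition sign_action :: "nat \<Rightarrow> (nat \<Rightarrow> int) \<Rightarrow> 'a::field mat \<Rightarrow> 'a mat" where
  "sign_action p s = restrict (sign_conj p (block_signs s)) (carrier (R_group p))"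

lemma sign_action_simps [simp]:
  "A \<in> carrier (R_group p) \<Longrightarrow> sign_action p s A = sign_conj p (block_signs s) A"
  "sign_action p s \<in> extensional (carrier (R_group p))"
  by (simp_all add: sign_action_def)

lemma sign_action_closed:
  "A \<in> carrier (R_group p) \<Longrightarrow> sign_action p s A \<in> carrier (R_group p)"
  by (simp add: sign_conj_in_R_group)

lemma sign_action_involution:
  "A \<in> carrier (R_group p) \<Longrightarrow> sign_action p s (sign_action p s A) = A"
  using sign_conj_in_R_group[of "block_signs s" A p]
  by (simp add: sign_conj_sign_conj sign_conj_one carrier_R_group)

lemma sign_action_auto: "sign_action p s \<in> auto (R_group p :: 'a::field mat monoid)"
proof -
  have "sign_action p s \<in> hom (R_group p) (R_group p :: 'a mat monoid)"
  proof (rule homI)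
    fix A B :: "'a mat" assume AB: "A \<in> carrier (R_group p)" "B \<in> carrier (R_group p)"
    interpret group "R_group p :: 'a mat monoid" by (rule group_R_group)
    have "A * B \<in> carrier (R_group p)" using m_closed[OF AB] by simp
    then show "sign_action p s (A \<otimes>\<^bsub>R_group p\<^esub> B) = sign_action p s A \<otimes>\<^bsub>R_group p\<^esub> sign_action p s B"
      using AB by (simp add: sign_conj_mult R_group_iff)
  qed (rule sign_action_closed)
  moreover have "bij_betw (sign_action p s) (carrier (R_group p)) (carrier (R_group p :: 'a mat monoid))"
    by (rule bij_betwI[where g = "sign_action p s"])
      (auto intro: sign_action_closed sign_action_involution simp del: sign_action_simps)
  ultimately show ?thesis by (simp add: auto_def Bij_def)
qed

text \<open>An entry outside the diagonal blocks lies in two different blocks of coordinates, of which the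
  one with the larger number \<open>m\<close> is not the normalised one. Changing the sign of \<open>m\<close> alone negates
  the entry, so a fixed matrix has a zero there, as \<open>2 \<noteq> 0\<close>.\<close>

lemma fixed_subgroup_sign_action:
  "fixed_subgroup (Z2_power (p - 1)) (R_group p) (sign_action p) =
    (H_group p :: 'a::field_char_0 mat set)"
proof -
  have "(\<forall>s\<in>carrier (Z2_power (p - 1)). sign_action p s A = A) \<longleftrightarrow> A \<in> block_diagonal p"
    if A: "A \<in> carrier (R_group p)" for A :: "'a mat"
  proof
    have c: "A \<in> carrier_mat (2 * p) (2 * p)" using A by (simp add: R_group_iff)
    assume fix_A: "\<forall>s\<in>carrier (Z2_power (p - 1)). sign_action p s A = A"
    have "A $$ (a, b) = 0" if ab: "a < 2 * p" "b < 2 * p" "a div 2 \<noteq> b div 2" for a b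
    proof -
      define m where "m = max (a div 2) (b div 2)"
      define s where "s = (\<lambda>k\<in>{1..p - 1}. if k = m then 1 else 0 :: int)"
      have m: "m \<in> {1..p - 1}" using ab by (auto simp: m_def)
      have s: "s \<in> carrier (Z2_power (p - 1))" by (auto simp: s_def Z2_power_carrier)
      have "block_signs s k = (if k = m then - 1 else 1 :: 'a)" if "k < p" for k
        using m that by (auto simp: block_signs_def s_def)
      moreover have "a div 2 < p" "b div 2 < p" using ab by auto
      ultimately have "block_signs s (a div 2) * block_signs s (b div 2) = (- 1 :: 'a)"
        using ab(3) by (auto simp: m_def max_def)
      moreover have "sign_conj p (block_signs s) A $$ (a, b) = A $$ (a, b)"
        using fix_A s A by simp
      ultimately have "- A $$ (a, b) = A $$ (a, b)" using ab by simp
      then show ?thesis by simp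
    qed
    then show "A \<in> block_diagonal p" using c by (simp add: block_diagonal_def)
  next
    assume "A \<in> block_diagonal p"
    then have "sign_conj p (block_signs s) A = A" for s
      by (intro eq_matI) (auto simp: block_diagonal_def, metis block_signs_square mult_1)
    then show "\<forall>s\<in>carrier (Z2_power (p - 1)). sign_action p s A = A" using A by simp
  qed
  then show ?thesis unfolding fixed_subgroup_def H_group_eq by blast
qed

lemma subgroup_fixed:
  assumes "group G" "\<And>s. s \<in> carrier S \<Longrightarrow> \<phi> s \<in> hom G G"
  shows "subgroup (fixed_subgroup S G \<phi>) G"
proof -
  interpret group G by fact
  have hom: "group_hom G G (\<phi> s)" if "s \<in> carrier S" for s
    using assms(2)[OF that] by unfold_locales
  show ?thesis
  proof (rule subgroupI)
    have "\<one>\<^bsub>G\<^esub> \<in> fixed_subgroup S G \<phi>"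
      using group_hom.hom_one[OF hom] by (simp add: fixed_subgroup_def)
    then show "fixed_subgroup S G \<phi> \<noteq> {}" by blast
  qed (use group_hom.hom_inv[OF hom] group_hom.hom_mult[OF hom] in \<open>auto simp: fixed_subgroup_def\<close>)
qed

lemma inj_on_sign_action:
  "inj_on (sign_action p :: _ \<Rightarrow> 'a::field_char_0 mat \<Rightarrow> 'a mat) (carrier (Z2_power (p - 1)))"
proof (rule inj_onI, rule ccontr)
  fix s t assume s: "s \<in> carrier (Z2_power (p - 1))" and t: "t \<in> carrier (Z2_power (p - 1))"
    and eq: "sign_action p s = (sign_action p t :: 'a mat \<Rightarrow> 'a mat)" and "s \<noteq> t"
  then obtain k where k: "k \<in> {1..p - 1}" "s k \<noteq> t k"
    using PiE_ext[of s "{1..p - 1}" "\<lambda>_. {0, 1}" t] unfolding Z2_power_carrier by blast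
  then have kp: "0 < k" "k < p" by auto
  obtain A :: "'a mat" where A: "A \<in> carrier (R_group p)" "A $$ (0, 2 * k + 1) = 1"
    using exists_symplectic_entry[OF kp] by blast
  have "sign_conj p (block_signs s) A = sign_conj p (block_signs t) A"
    using fun_cong[OF eq, of A] A by simp
  then have "sign_conj p (block_signs s) A $$ (0, 2 * k + 1) = sign_conj p (block_signs t) A $$ (0, 2 * k + 1)"
    by simp
  moreover have "sign_conj p (block_signs u) A $$ (0, 2 * k + 1) = block_signs u k" for u
    using A(2) kp by (simp add: block_signs_def)
  ultimately have "block_signs s k = (block_signs t k :: 'a)" by metis
  moreover have "s k \<in> {0, 1}" "t k \<in> {0, 1}" using s t k(1) by (auto simp: Z2_power_carrier PiE_iff)
  ultimately show False using k(2) kp by (auto simp: block_signs_def)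
qed

lemma sign_action_hom:
  assumes mor: "\<And>e f. (\<And>A. A \<in> carrier (R_group p) \<Longrightarrow> f A = sign_conj p e A) \<Longrightarrow>
    mor (carrier (R_group p)) f"
  shows "sign_action p \<in> hom (Z2_power (p - 1)) (Aut_group mor (R_group p :: 'a::field mat monoid))"
proof (rule homI)
  let ?X = "carrier (R_group p :: 'a mat monoid)"
  show "sign_action p s \<in> carrier (Aut_group mor (R_group p :: 'a mat monoid))" for s
  proof -
    have "inv_into ?X (sign_action p s) A = sign_conj p (block_signs s) A" if "A \<in> ?X" for A
    proof -
      have "inj_on (sign_action p s) ?X"
        by (rule inj_on_inverseI[of _ "sign_action p s"]) (rule sign_action_involution)
      then have "inv_into ?X (sign_action p s) (sign_action p s (sign_action p s A)) = sign_action p s A"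
        using sign_action_closed[OF that] by (rule inv_into_f_f)
      then show ?thesis using sign_action_involution[OF that] that by simp
    qed
    then show ?thesis
      using sign_action_auto[of p s] mor[of "inv_into ?X (sign_action p s)" "block_signs s"]
        mor[of "sign_action p s" "block_signs s"]
      by (simp add: Aut_group_def)
  qed
  fix s t assume st: "s \<in> carrier (Z2_power (p - 1))" "t \<in> carrier (Z2_power (p - 1))"
  let ?st = "s \<otimes>\<^bsub>Z2_power (p - 1)\<^esub> t"
  have "sign_action p ?st = compose ?X (sign_action p s) (sign_action p t)"
  proof (rule extensionalityI)
    fix A assume A: "A \<in> ?X"
    have "sign_conj p (block_signs ?st) A = sign_conj p (\<lambda>k. block_signs s k * block_signs t k) A"
    proof (rule eq_matI)
      fix a b assume "a < dim_row (sign_conj p (\<lambda>k. block_signs s k * block_signs t k) A)"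
        "b < dim_col (sign_conj p (\<lambda>k. block_signs s k * block_signs t k) A)"
      then have ab: "a < 2 * p" "b < 2 * p" by simp_all
      then have "a div 2 < p" "b div 2 < p" by auto
      then show "sign_conj p (block_signs ?st) A $$ (a, b) =
          sign_conj p (\<lambda>k. block_signs s k * block_signs t k) A $$ (a, b)"
        using ab block_signs_mult[OF st, where 'a = 'a] by simp
    qed simp_all
    then show "sign_action p ?st A = compose ?X (sign_action p s) (sign_action p t) A"
      using A by (simp add: compose_def sign_conj_in_R_group sign_conj_sign_conj)
  qed simp_all
  moreover have "sign_action p u \<in> Bij ?X" for u
    using sign_action_auto by (auto simp: auto_def)
  ultimately show "sign_action p ?st =
      sign_action p s \<otimes>\<^bsub>Aut_group mor (R_group p :: 'a mat monoid)\<^esub> sign_action p t"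
    by (simp add: Aut_group_def AutoGroup_def BijGroup_def)
qed

text \<open>Only two properties of the topology and of the notion of morphism matter, and both the
  algebraic and the complex setting have them.\<close>

lemma symmetric_structure_sign_action:
  fixes T :: "'a::field_char_0 mat topology"
  assumes closed: "\<And>S. closedin (zariski_GL TYPE('a) (2 * p)) S \<Longrightarrow> closedin T S"
    and mor: "\<And>e f. (\<And>A. A \<in> carrier (R_group p) \<Longrightarrow> f A = sign_conj p e A) \<Longrightarrow>
      mor (carrier (R_group p)) f"
  shows "symmetric_structure (2 * p) T mor (Z2_power (p - 1)) (R_group p) (H_group p) (sign_action p)"
  unfolding symmetric_structure_def
proof (intro conjI)
  show "comm_group (Z2_power (p - 1))" by (rule comm_group_Z2_power)
  show "finite (carrier (Z2_power (p - 1)))" by (simp add: Z2_power_carrier finite_PiE)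
  show "subgroup (carrier (R_group p)) (GL TYPE('a) (2 * p))" by (rule subgroup_R_group)
  show "R_group p = (GL TYPE('a) (2 * p))\<lparr>carrier := carrier (R_group p)\<rparr>"
    by (simp add: R_group_def)
  show "closedin T (carrier (R_group p))" by (rule closed[OF closedin_zariski_R_group])
  show "subgroup (H_group p) (R_group p :: 'a mat monoid)"
    unfolding fixed_subgroup_sign_action[symmetric]
    using sign_action_auto by (intro subgroup_fixed group_R_group) (auto simp: auto_def)
  have "H_group p = (carrier (GL TYPE('a) (2 * p)) \<inter> block_diagonal p) \<inter> carrier (R_group p)"
    by (auto simp: H_group_eq R_group_def)
  then show "closedin (subtopology T (carrier (R_group p))) (H_group p)"
    using closed[OF closedin_zariski_block_diagonal] unfolding closedin_subtopology by blast
  show "sign_action p \<in> hom (Z2_power (p - 1)) (Aut_group mor (R_group p))"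
    using mor by (rule sign_action_hom)
  show "inj_on (sign_action p :: _ \<Rightarrow> 'a mat \<Rightarrow> _) (carrier (Z2_power (p - 1)))"
    by (rule inj_on_sign_action)
  show "connected_component_of_set
      (subtopology T (fixed_subgroup (Z2_power (p - 1)) (R_group p) (sign_action p)))
      \<one>\<^bsub>R_group p\<^esub> \<subseteq> H_group p"
    using connected_component_of_subset_topspace
    unfolding fixed_subgroup_sign_action by fastforce
  show "H_group p \<subseteq> fixed_subgroup (Z2_power (p - 1)) (R_group p) (sign_action p :: _ \<Rightarrow> 'a mat \<Rightarrow> _)"
    unfolding fixed_subgroup_sign_action by simp
qed

theorem theorem24:
  fixes p :: nat
  assumes "2 \<le> p"
  shows
    "lie_subalgebra (2 * p) (r_alg p :: 'a::{alg_closed_field, field_char_0} mat set) \<and>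
     is_direct_sum (2 * p) (r_alg p :: 'a mat set) (h_alg p) (Gamma_set p) (m_alg p) \<and>
     lie_iso_product (diagonal_blocks p) (h_alg p :: 'a mat set) {1..p} (\<lambda>_. sl_alg 2) \<and>
     (\<forall>g \<in> Gamma_set p.
        bracket_space (2 * p) (m_alg p g) (m_alg p g) \<subseteq> (h_alg p :: 'a mat set) \<and>
        bracket_space (2 * p) (m_alg p g) (h_alg p) \<subseteq> (m_alg p g :: 'a mat set)) \<and>
     (\<forall>g \<in> Gamma_set p. \<forall>g' \<in> Gamma_set p. g \<noteq> g' \<longrightarrow>
        (let s = g \<otimes>\<^bsub>Z2_power (p - 1)\<^esub> g' in
         if s \<in> Gamma_set p
         then bracket_space (2 * p) (m_alg p g) (m_alg p g') \<subseteq> (m_alg p s :: 'a mat set)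
         else bracket_space (2 * p) (m_alg p g) (m_alg p g' :: 'a mat set)
                = {0\<^sub>m (2 * p) (2 * p)})) \<and>
     (\<exists>\<phi>. algebraic_symmetric_structure (2 * p) (Z2_power (p - 1))
        (R_group p :: 'a mat monoid) (H_group p) \<phi>) \<and>
     (\<exists>\<phi>. complex_symmetric_structure (2 * p) (Z2_power (p - 1)) (R_group p) (H_group p) \<phi>)"
proof -
  interpret Z2: comm_group "Z2_power (p - 1)" by (rule comm_group_Z2_power)
  have in_Z2: "g \<in> carrier (Z2_power (p - 1))" if "g \<in> Gamma_set p" for g
    using that by (simp add: Gamma_set_def)
  have "lie_subalgebra (2 * p) (r_alg p :: 'a mat set)"
    by (simp add: lie_subalgebra_def mat_subspace_r_alg lie_bracket_in_r_alg)
  moreover have "bracket_space (2 * p) (m_alg p g) (m_alg p g) \<subseteq> (h_alg p :: 'a mat set)"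
    "bracket_space (2 * p) (m_alg p g) (h_alg p) \<subseteq> (m_alg p g :: 'a mat set)"
    if g: "g \<in> Gamma_set p" for g
    using bracket_space_graded[of p g g, where 'a = 'a]
      bracket_space_graded[of p g "\<one>\<^bsub>Z2_power (p - 1)\<^esub>", where 'a = 'a]
    by (simp_all only: Z2_power_mult_self[OF in_Z2[OF g]] Z2.r_one[OF in_Z2[OF g]]
        graded_part_one graded_part_Gamma[OF g])
  moreover have "let s = g \<otimes>\<^bsub>Z2_power (p - 1)\<^esub> g' in
         if s \<in> Gamma_set p
         then bracket_space (2 * p) (m_alg p g) (m_alg p g') \<subseteq> (m_alg p s :: 'a mat set)
         else bracket_space (2 * p) (m_alg p g) (m_alg p g' :: 'a mat set)
                = {0\<^sub>m (2 * p) (2 * p)}"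
    if g: "g \<in> Gamma_set p" and g': "g' \<in> Gamma_set p" and ne: "g \<noteq> g'" for g g'
  proof -
    let ?s = "g \<otimes>\<^bsub>Z2_power (p - 1)\<^esub> g'"
    have sub: "bracket_space (2 * p) (m_alg p g) (m_alg p g' :: 'a mat set) \<subseteq> graded_part p ?s"
      using bracket_space_graded[of p g g', where 'a = 'a]
      by (simp only: graded_part_Gamma[OF g] graded_part_Gamma[OF g'])
    have "?s \<noteq> \<one>\<^bsub>Z2_power (p - 1)\<^esub>"
    proof
      assume "?s = \<one>\<^bsub>Z2_power (p - 1)\<^esub>"
      then have "inv\<^bsub>Z2_power (p - 1)\<^esub> g' = g"
        by (rule Z2.inv_equality[OF _ in_Z2[OF g'] in_Z2[OF g]])
      moreover have "inv\<^bsub>Z2_power (p - 1)\<^esub> g' = g'"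
        by (rule Z2.inv_equality[OF Z2_power_mult_self in_Z2 in_Z2]) (use g' in_Z2 in auto)
      ultimately show False using ne by simp
    qed
    then have "bracket_space (2 * p) (m_alg p g) (m_alg p g' :: 'a mat set) \<subseteq> {0\<^sub>m (2 * p) (2 * p)}"
      if "?s \<notin> Gamma_set p" using that sub graded_part_trivial by blast
    then show ?thesis
      using sub zero_in_bracket_space[of "2 * p" "m_alg p g" "m_alg p g' :: 'a mat set"]
      by (auto simp: Let_def graded_part_Gamma)
  qed
  moreover have "algebraic_symmetric_structure (2 * p) (Z2_power (p - 1))
      (R_group p :: 'a mat monoid) (H_group p) (sign_action p)"
    unfolding algebraic_symmetric_structure_def
    by (rule symmetric_structure_sign_action) (auto intro: regular_map_sign_conj)
  moreover have "complex_symmetric_structure (2 * p) (Z2_power (p - 1))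
      (R_group p) (H_group p) (sign_action p)"
    unfolding complex_symmetric_structure_def
    by (rule symmetric_structure_sign_action)
      (auto intro: holomorphic_map_sign_conj closedin_zariski_imp_classical simp: R_group_iff)
  ultimately show ?thesis
    using is_direct_sum_r_alg lie_iso_product_h_alg by blast
qed

end
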